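(* Let $(X,\mathcal{A})$ be a measurable space ($\mathcal{A}$ a $\sigma$-algebra on $X$), let $\lambda\colon\mathcal{A}\to[0,\infty]$ be a measure on $(X,\mathcal{A})$, and let $\lambda^{\diamond}\colon\mathsf{S}(\mathcal{A})\to[0,\infty]$ be the measure on $\mathsf{S}(\mathcal{A})$ obtained from $\lambda$ by Simpson's extension theorem; it extends $\lambda$ in the sense that $\lambda^{\diamond}(\mathfrak{o}(A))=\lambda(A)$ for every $A\in\mathcal{A}$. Let $\tilde f=\sum_{i=1}^n r_i\mathds{1}_{A_i}\colon X\to\mathbb{R}$, where $n\in\mathbb{N}$, $r_1<\cdots<r_n$ are rational and $A_1,\ldots,A_n\in\mathcal{A}$ are pairwise disjoint with $\bigcup_{i=1}^n A_i=X$. Let $f\in\mathsf{M}(\mathcal{A})$ be its localic counterpart, determined by $f(p,\text{---})=\tilde f^{-1}(]p,+\infty[)$ and $f(\text{---},q)=\tilde f^{-1}(]-\infty,q[)$ for $p,q\in\mathbb{Q}$. Then $f$ is the localic simple function $f=\sum_{i=1}^n r_i\cdot\chi_{A_i}$, and, identifying $f$ with $\nabla\circ f\in\mathsf{M}(\mathcal{C}(\mathcal{A}))$, one has $f=\sum_{i=1}^n r_i\cdot\chi_{\nabla_{A_i}}$. If $\tilde f$ is nonnegative, then $\int_X\tilde f\,d\lambda=\int_{\mathcal{A}}f\,d\lambda^{\diamond}$. For general $\tilde f$, $\tilde f$ is $\lambda$-integrable if and only if $f$ is $\lambda^{\diamond}$-integrable, and in that case $$\int_X\tilde f\,d\lam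bda=\int_{\mathcal{A}}f\,d\lambda^{\diamond}.$$
   Context: $\mathds{1}_A$ is the indicator function of $A$. Classical integral: a nonnegative simple function $\tilde f=\sum r_i\mathds{1}_{A_i}$ ($A_i\in\mathcal{A}$ pairwise disjoint with union $X$) has $\int_X\tilde f\,d\lambda=\sum_i r_i\lambda(A_i)$ (with $0\cdot\infty=0$). A general simple $\tilde f$ is called $\lambda$-integrable if $\int_X\tilde f^+d\lambda<\infty$ or $\int_X\tilde f^-d\lambda<\infty$, and then $\int_X\tilde f\,d\lambda=\int_X\tilde f^+d\lambda-\int_X\tilde f^-d\lambda$ (possibly $\pm\infty$). A $\sigma$-frame is a bounded lattice with all countable joins in which $(\bigvee_{a\in A}a)\wedge b=\bigvee_{a\in A}(a\wedge b)$ for every countable $A$ and every $b$ (e.g. the $\sigma$-algebra $\mathcal{A}$ under inclusion). A $\sigma$-frame homomorphism preserves finite meets (including the top) and countable joins (including the bottom). A congruence on a $\sigma$-frame $L$ is an equivalence relation on $L$ closed under binary meets and countable joins. $\mathcal{C}(L)$, the set of all congruences ordered by inclusion, is a frame. $\mathsf{S}(L)$ is the dual lattice $\mathcal{C}(L)^{op}$; its elements are the $\sigma$-sublocales of $L$. The congruence corresponding to $S\in\mathsf{S}(L)$ is $\theta_S$, so $S\le T$ iff $\theta_T\subseteq\theta_S$. The bottom of $\mathsf{S}(L)$ corresponds to $L\times L$ and the top $1_{\mathsf{S}(L)}$ (identified with $L$) to equality. For $a\in L$, $\nabla_a=\{(x,y)\mid x\vee a=y\vee a\}$ and $\Delta_a=\{(x,y)\mid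 x\wedge a=y\wedge a\}$ are complementary congruences; $\nabla\colon L\to\mathcal{C}(L)$, $a\mapsto\nabla_a$, is an embedding of $\sigma$-frames; $\mathfrak{o}(a)\in\mathsf{S}(L)$ is the $\sigma$-sublocale with congruence $\Delta_a$. Complements are denoted $(\cdot)^c$. A measure on a lattice $K$ with bottom and countable joins is a map $\mu\colon K\to[0,\infty]$ with: (M1) $\mu(0)=0$; (M2) $x\le y\Rightarrow\mu(x)\le\mu(y)$; (M3) $\mu(x)+\mu(y)=\mu(x\vee y)+\mu(x\wedge y)$; (M4) $\mu(\bigvee_i x_i)=\sup_i\mu(x_i)$ for every increasing sequence $(x_i)_{i\in\mathbb{N}}$. The classical measure $\lambda$ is a measure on the lattice $\mathcal{A}$ in this sense. Since every element of $\mathcal{A}$ is complemented, Theorem 1 of A. Simpson's 2012 paper on measure and sublocales applies and yields the measure $\lambda^{\diamond}$ on $\mathsf{S}(\mathcal{A})$; explicitly, $\lambda^{\diamond}(S)=\inf\{\lambda(A)\mid A\in\mathcal{A},\ S\le\mathfrak{o}(A)\}$. $\mathfrak{L}(\mathbb{R})$ is the frame, equivalently $\sigma$-frame, generated by symbols $(p,\text{---})$, $(\text{---},q)$ ($p,q\in\mathbb{Q}$) subject to: $(p,\text{---})\wedge(\text{---},q)=0$ if $p\ge q$; $(p,\text{---})\vee(\text{---},q)=1$ if $p<q$; $(p,\text{---})=\bigvee_{r>p}(r,\text{---})$; $(\text{---},q)=\bigvee_{s<q}(\text{---},s)$; $\bigvee_p(p,\text{---})=1=\bigvee_q(\text{---},q)$.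 For a $\sigma$-frame $N$, $\mathsf{M}(N)$ is the set of $\sigma$-frame homomorphisms $\mathfrak{L}(\mathbb{R})\to N$, ordered by $f\le g$ iff $f(p,\text{---})\le g(p,\text{---})$ for all $p$. Operations on $\mathsf{M}(N)$: $(\lambda\cdot f)(p,\text{---})=f(p/\lambda,\text{---})$, $(\lambda\cdot f)(\text{---},q)=f(\text{---},q/\lambda)$ for rational $\lambda>0$; $(-f)(p,\text{---})=f(\text{---},-p)$, $(-f)(\text{---},q)=f(-q,\text{---})$; $0\cdot f=\mathbf{0}$ and $\lambda\cdot f=-((-\lambda)\cdot f)$ for $\lambda<0$; $(f+g)(p,\text{---})=\bigvee_{t\in\mathbb{Q}}(f(t,\text{---})\wedge g(p-t,\text{---}))$, $(f+g)(\text{---},q)=\bigvee_{t\in\mathbb{Q}}(f(\text{---},t)\wedge g(\text{---},q-t))$; $(f\vee g)(p,\text{---})=f(p,\text{---})\vee g(p,\text{---})$, $(f\vee g)(\text{---},q)=f(\text{---},q)\wedge g(\text{---},q)$. Here $\mathbf{0}(p,\text{---})=1$ if $p<0$, else $0$; $\mathbf{0}(\text{---},q)=1$ if $q>0$, else $0$. $f$ is nonnegative if $f\ge\mathbf{0}$; $f^+=f\vee\mathbf{0}$, $f^-=(-f)\vee\mathbf{0}$. For complemented $a\in N$, $\chi_a(p,\text{---})=1$ if $p<0$, $a$ if $0\le p<1$, $0$ if $p\ge1$; $\chi_a(\text{---},q)=0$ if $q\le0$, $a^c$ if $0<q\le1$, $1$ if $q>1$. $\mathsf{SM}(N)$ is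 the set of simple functions: those $f\in\mathsf{M}(N)$ of the form $\sum_{i=1}^n r_i\cdot\chi_{a_i}$ with $n\in\mathbb{N}$, $r_i\in\mathbb{Q}$ and $a_i\in N$ complemented. The canonical form of a simple function is its expression $\sum_{i=1}^n r_i\cdot\chi_{a_i}$ with $r_1<\cdots<r_n$ and the $a_i$ nonzero, complemented, pairwise disjoint, with $\bigvee_{i=1}^n a_i=1$; it is unique. The positive and negative parts of a simple function are simple. Localic integral: let $\mu$ be a measure on $\mathsf{S}(L)$. If $g\in\mathsf{SM}(\mathcal{C}(L))$ is nonnegative with canonical form $\sum_{i=1}^n r_i\cdot\chi_{\theta_{S_i}^c}$, then $\int_L g\,d\mu=\sum_{i=1}^n r_i\,\mu(S_i)$, with $0\cdot\infty=0$. A general $g\in\mathsf{SM}(\mathcal{C}(L))$ is $\mu$-integrable if $\int_L g^+d\mu<\infty$ or $\int_L g^-d\mu<\infty$, and then $\int_L g\,d\mu=\int_L g^+d\mu-\int_L g^-d\mu$ (possibly $\pm\infty$). *)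

theory Defs
  imports
    "HOL-Analysis.Analysis"
    "HOL-Algebra.Lattice"
    "HOL-Library.Countable_Set_Type"
begin

section \<open>Sigma-frames\<close>

text \<open>
  Ordered structures are \<^typ>\<open>'a gorder\<close> records; every structure below has equality as its
  \<open>eq\<close> component, so that joins, meets, top and bottom are the library's.
\<close>

definition sigma_frame_hom :: "'a gorder \<Rightarrow> 'b gorder \<Rightarrow> ('a \<Rightarrow> 'b) \<Rightarrow> bool" where
  "sigma_frame_hom L N h \<longleftrightarrow>
     h \<in> carrier L \<rightarrow> carrier N \<and>
     h \<top>\<^bsub>L\<^esub> = \<top>\<^bsub>N\<^esub> \<and>
     (\<forall>x \<in> carrier L. \<forall>y \<in> carrier L. h (x \<sqinter>\<^bsub>L\<^esub> y) = h x \<sqinter>\<^bsub>N\<^esub> h y) \<and>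
     (\<forall>C. C \<subseteq> carrier L \<and> countable C \<longrightarrow> h (\<Squnion>\<^bsub>L\<^esub> C) = \<Squnion>\<^bsub>N\<^esub> (h ` C))"

definition is_complement :: "'a gorder \<Rightarrow> 'a \<Rightarrow> 'a \<Rightarrow> bool" where
  "is_complement N a b \<longleftrightarrow>
     a \<in> carrier N \<and> b \<in> carrier N \<and> a \<sqinter>\<^bsub>N\<^esub> b = \<bottom>\<^bsub>N\<^esub> \<and> a \<squnion>\<^bsub>N\<^esub> b = \<top>\<^bsub>N\<^esub>"

definition complemented :: "'a gorder \<Rightarrow> 'a \<Rightarrow> bool" where
  "complemented N a \<longleftrightarrow> (\<exists>b. is_complement N a b)"

definition compl :: "'a gorder \<Rightarrow> 'a \<Rightarrow> 'a" where
  "compl N a = (THE b. is_complement N a b)"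

definition sets_frame :: "'x measure \<Rightarrow> 'x set gorder" where
  "sets_frame M = \<lparr>carrier = sets M, eq = (=), le = (\<subseteq>)\<rparr>"


section \<open>Congruences and sigma-sublocales\<close>

definition congruence :: "'a gorder \<Rightarrow> ('a \<times> 'a) set \<Rightarrow> bool" where
  "congruence L \<theta> \<longleftrightarrow>
     equiv (carrier L) \<theta> \<and>
     (\<forall>x x' y y'. (x, x') \<in> \<theta> \<and> (y, y') \<in> \<theta> \<longrightarrow> (x \<sqinter>\<^bsub>L\<^esub> y, x' \<sqinter>\<^bsub>L\<^esub> y') \<in> \<theta>) \<and>
     (\<forall>C. C \<subseteq> \<theta> \<and> countable C \<longrightarrow> (\<Squnion>\<^bsub>L\<^esub> (fst ` C), \<Squnion>\<^bsub>L\<^esub> (snd ` C)) \<in> \<theta>)"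

definition Cong :: "'a gorder \<Rightarrow> ('a \<times> 'a) set gorder" where
  "Cong L = \<lparr>carrier = {\<theta>. congruence L \<theta>}, eq = (=), le = (\<subseteq>)\<rparr>"

text \<open>A sigma-sublocale \<open>S\<close> is represented by its congruence \<open>\<theta>\<^sub>S\<close> itself.\<close>

definition Subloc :: "'a gorder \<Rightarrow> ('a \<times> 'a) set gorder" where
  "Subloc L = inv_gorder (Cong L)"

definition nabla :: "'a gorder \<Rightarrow> 'a \<Rightarrow> ('a \<times> 'a) set" where
  "nabla L a = {(x, y). x \<in> carrier L \<and> y \<in> carrier L \<and> x \<squnion>\<^bsub>L\<^esub> a = y \<squnion>\<^bsub>L\<^esub> a}"

definition delta :: "'a gorder \<Rightarrow> 'a \<Rightarrow> ('a \<times> 'a) set" where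
  "delta L a = {(x, y). x \<in> carrier L \<and> y \<in> carrier L \<and> x \<sqinter>\<^bsub>L\<^esub> a = y \<sqinter>\<^bsub>L\<^esub> a}"

definition open_subloc :: "'a gorder \<Rightarrow> 'a \<Rightarrow> ('a \<times> 'a) set" where
  "open_subloc L a = delta L a"

text \<open>Simpson's extension of a measure on \<open>L\<close> to the sigma-sublocales of \<open>L\<close>.\<close>

definition simpson_ext :: "'a gorder \<Rightarrow> ('a \<Rightarrow> ennreal) \<Rightarrow> ('a \<times> 'a) set \<Rightarrow> ennreal" where
  "simpson_ext L \<mu> S = (INF a \<in> {a \<in> carrier L. S \<sqsubseteq>\<^bsub>Subloc L\<^esub> open_subloc L a}. \<mu> a)"


section \<open>The sigma-frame of reals\<close>

text \<open>
  The presentation by generators and relations: terms over the generators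
  (\<open>RGt p\<close> for \<open>(p,---)\<close>, \<open>RLt q\<close> for \<open>(---,q)\<close>), ordered by the least preorder that satisfies
  the sigma-frame laws and the defining relations, modulo mutual inequality.
\<close>

datatype rterm = RGt rat | RLt rat | RTop | RMeet rterm rterm | RJoin "rterm cset"

inductive rle :: "rterm \<Rightarrow> rterm \<Rightarrow> bool" where
  rle_refl: "rle s s"
| rle_trans: "rle s t \<Longrightarrow> rle t u \<Longrightarrow> rle s u"
| rle_top: "rle s RTop"
| rle_meet1: "rle (RMeet s t) s"
| rle_meet2: "rle (RMeet s t) t"
| rle_meetI: "rle u s \<Longrightarrow> rle u t \<Longrightarrow> rle u (RMeet s t)"
| rle_joinI: "t \<in> rcset C \<Longrightarrow> rle t (RJoin C)"
| rle_joinE: "(\<And>t. t \<in> rcset C \<Longrightarrow> rle t u) \<Longrightarrow> rle (RJoin C) u"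
| rle_distrib: "rle (RMeet (RJoin C) u) (RJoin (cimage (\<lambda>t. RMeet t u) C))"
| rle_disjoint: "q \<le> p \<Longrightarrow> rle (RMeet (RGt p) (RLt q)) (RJoin cempty)"
| rle_cover: "p < q \<Longrightarrow> rle RTop (RJoin (acset {RGt p, RLt q}))"
| rle_Gt1: "rle (RGt p) (RJoin (acset {RGt r |r. p < r}))"
| rle_Gt2: "rle (RJoin (acset {RGt r |r. p < r})) (RGt p)"
| rle_Lt1: "rle (RLt q) (RJoin (acset {RLt s |s. s < q}))"
| rle_Lt2: "rle (RJoin (acset {RLt s |s. s < q})) (RLt q)"
| rle_all_Gt: "rle RTop (RJoin (acset (range RGt)))"
| rle_all_Lt: "rle RTop (RJoin (acset (range RLt)))"

quotient_type lreal = rterm / "\<lambda>s t. rle s t \<and> rle t s"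
  by (rule equivpI) (auto simp: reflp_def symp_def transp_def intro: rle_refl rle_trans)

lift_definition lreal_le :: "lreal \<Rightarrow> lreal \<Rightarrow> bool" is rle
  by (blast intro: rle_trans)

lift_definition gt :: "rat \<Rightarrow> lreal" is RGt .

lift_definition lt :: "rat \<Rightarrow> lreal" is RLt .

definition LR :: "lreal gorder" where
  "LR = \<lparr>carrier = UNIV, eq = (=), le = lreal_le\<rparr>"


section \<open>Localic real functions\<close>

definition MF :: "'a gorder \<Rightarrow> (lreal \<Rightarrow> 'a) set" where
  "MF N = {f. sigma_frame_hom LR N f}"

text \<open>The unique homomorphism with prescribed values on the generators.\<close>

definition from_gens :: "'a gorder \<Rightarrow> (rat \<Rightarrow> 'a) \<Rightarrow> (rat \<Rightarrow> 'a) \<Rightarrow> lreal \<Rightarrow> 'a" where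
  "from_gens N u l = (THE h. h \<in> MF N \<and> (\<forall>p. h (gt p) = u p) \<and> (\<forall>q. h (lt q) = l q))"

definition mf_le :: "'a gorder \<Rightarrow> (lreal \<Rightarrow> 'a) \<Rightarrow> (lreal \<Rightarrow> 'a) \<Rightarrow> bool" where
  "mf_le N f g \<longleftrightarrow> (\<forall>p. f (gt p) \<sqsubseteq>\<^bsub>N\<^esub> g (gt p))"

definition mf_zero :: "'a gorder \<Rightarrow> lreal \<Rightarrow> 'a" where
  "mf_zero N = from_gens N
     (\<lambda>p. if p < 0 then \<top>\<^bsub>N\<^esub> else \<bottom>\<^bsub>N\<^esub>) (\<lambda>q. if q > 0 then \<top>\<^bsub>N\<^esub> else \<bottom>\<^bsub>N\<^esub>)"

definition mf_neg :: "'a gorder \<Rightarrow> (lreal \<Rightarrow> 'a) \<Rightarrow> lreal \<Rightarrow> 'a" where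
  "mf_neg N f = from_gens N (\<lambda>p. f (lt (- p))) (\<lambda>q. f (gt (- q)))"

definition mf_scale_pos :: "'a gorder \<Rightarrow> rat \<Rightarrow> (lreal \<Rightarrow> 'a) \<Rightarrow> lreal \<Rightarrow> 'a" where
  "mf_scale_pos N c f = from_gens N (\<lambda>p. f (gt (p / c))) (\<lambda>q. f (lt (q / c)))"

definition mf_scale :: "'a gorder \<Rightarrow> rat \<Rightarrow> (lreal \<Rightarrow> 'a) \<Rightarrow> lreal \<Rightarrow> 'a" where
  "mf_scale N c f =
     (if c > 0 then mf_scale_pos N c f
      else if c = 0 then mf_zero N
      else mf_neg N (mf_scale_pos N (- c) f))"

definition mf_add :: "'a gorder \<Rightarrow> (lreal \<Rightarrow> 'a) \<Rightarrow> (lreal \<Rightarrow> 'a) \<Rightarrow> lreal \<Rightarrow> 'a" where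
  "mf_add N f g = from_gens N
     (\<lambda>p. \<Squnion>\<^bsub>N\<^esub> (range (\<lambda>t. f (gt t) \<sqinter>\<^bsub>N\<^esub> g (gt (p - t)))))
     (\<lambda>q. \<Squnion>\<^bsub>N\<^esub> (range (\<lambda>t. f (lt t) \<sqinter>\<^bsub>N\<^esub> g (lt (q - t)))))"

definition mf_sup :: "'a gorder \<Rightarrow> (lreal \<Rightarrow> 'a) \<Rightarrow> (lreal \<Rightarrow> 'a) \<Rightarrow> lreal \<Rightarrow> 'a" where
  "mf_sup N f g = from_gens N
     (\<lambda>p. f (gt p) \<squnion>\<^bsub>N\<^esub> g (gt p)) (\<lambda>q. f (lt q) \<sqinter>\<^bsub>N\<^esub> g (lt q))"

definition mf_nonneg :: "'a gorder \<Rightarrow> (lreal \<Rightarrow> 'a) \<Rightarrow> bool" where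
  "mf_nonneg N f \<longleftrightarrow> mf_le N (mf_zero N) f"

definition mf_pos :: "'a gorder \<Rightarrow> (lreal \<Rightarrow> 'a) \<Rightarrow> lreal \<Rightarrow> 'a" where
  "mf_pos N f = mf_sup N f (mf_zero N)"

definition mf_negpart :: "'a gorder \<Rightarrow> (lreal \<Rightarrow> 'a) \<Rightarrow> lreal \<Rightarrow> 'a" where
  "mf_negpart N f = mf_sup N (mf_neg N f) (mf_zero N)"

definition chi :: "'a gorder \<Rightarrow> 'a \<Rightarrow> lreal \<Rightarrow> 'a" where
  "chi N a = from_gens N
     (\<lambda>p. if p < 0 then \<top>\<^bsub>N\<^esub> else if p < 1 then a else \<bottom>\<^bsub>N\<^esub>)
     (\<lambda>q. if q \<le> 0 then \<bottom>\<^bsub>N\<^esub> else if q \<le> 1 then compl N a else \<top>\<^bsub>N\<^esub>)"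

text \<open>\<open>simple_sum N n r a\<close> is the sum of \<open>r i \<cdot> \<chi> (a i)\<close> for \<open>i = 1, \<dots>, n\<close> in \<^term>\<open>MF N\<close>.\<close>

primrec simple_sum :: "'a gorder \<Rightarrow> nat \<Rightarrow> (nat \<Rightarrow> rat) \<Rightarrow> (nat \<Rightarrow> 'a) \<Rightarrow> lreal \<Rightarrow> 'a" where
  "simple_sum N 0 r a = mf_zero N"
| "simple_sum N (Suc n) r a =
     mf_add N (simple_sum N n r a) (mf_scale N (r (Suc n)) (chi N (a (Suc n))))"

definition SM :: "'a gorder \<Rightarrow> (lreal \<Rightarrow> 'a) set" where
  "SM N = {f \<in> MF N. \<exists>n r a. (\<forall>i \<in> {1..n}. complemented N (a i)) \<and> f = simple_sum N n r a}"

definition canonical_form ::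
    "'a gorder \<Rightarrow> (lreal \<Rightarrow> 'a) \<Rightarrow> nat \<Rightarrow> (nat \<Rightarrow> rat) \<Rightarrow> (nat \<Rightarrow> 'a) \<Rightarrow> bool" where
  "canonical_form N f n r a \<longleftrightarrow>
     f = simple_sum N n r a \<and>
     strict_mono_on {1..n} r \<and>
     (\<forall>i \<in> {1..n}. complemented N (a i) \<and> a i \<noteq> \<bottom>\<^bsub>N\<^esub>) \<and>
     (\<forall>i \<in> {1..n}. \<forall>j \<in> {1..n}. i \<noteq> j \<longrightarrow> a i \<sqinter>\<^bsub>N\<^esub> a j = \<bottom>\<^bsub>N\<^esub>) \<and>
     \<Squnion>\<^bsub>N\<^esub> (a ` {1..n}) = \<top>\<^bsub>N\<^esub>"


section \<open>The localic integral\<close>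

text \<open>
  For nonnegative \<^term>\<open>g \<in> SM (Cong L)\<close>. In the canonical form \<open>a i\<close> is the complement of
  \<open>\<theta>\<close> for the sigma-sublocale \<open>S i\<close>, so \<open>S i = compl (Cong L) (a i)\<close>. The coefficients of such
  a \<open>g\<close> are nonnegative, so \<^const>\<open>ennreal\<close> does not truncate; \<open>0 * \<infinity> = 0\<close> in \<^typ>\<open>ennreal\<close>.
\<close>

definition localic_nn_integral ::
    "'a gorder \<Rightarrow> (('a \<times> 'a) set \<Rightarrow> ennreal) \<Rightarrow> (lreal \<Rightarrow> ('a \<times> 'a) set) \<Rightarrow> ennreal" where
  "localic_nn_integral L \<mu> g =
     (THE v. \<exists>n r a. canonical_form (Cong L) g n r a \<and>
        v = (\<Sum>i = 1..n. ennreal (of_rat (r i)) * \<mu> (compl (Cong L) (a i))))"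

definition localic_integrable ::
    "'a gorder \<Rightarrow> (('a \<times> 'a) set \<Rightarrow> ennreal) \<Rightarrow> (lreal \<Rightarrow> ('a \<times> 'a) set) \<Rightarrow> bool" where
  "localic_integrable L \<mu> g \<longleftrightarrow>
     g \<in> SM (Cong L) \<and>
     (localic_nn_integral L \<mu> (mf_pos (Cong L) g) < \<infinity> \<or>
      localic_nn_integral L \<mu> (mf_negpart (Cong L) g) < \<infinity>)"

definition localic_integral ::
    "'a gorder \<Rightarrow> (('a \<times> 'a) set \<Rightarrow> ennreal) \<Rightarrow> (lreal \<Rightarrow> ('a \<times> 'a) set) \<Rightarrow> ereal" where
  "localic_integral L \<mu> g =
     enn2ereal (localic_nn_integral L \<mu> (mf_pos (Cong L) g)) -
     enn2ereal (localic_nn_integral L \<mu> (mf_negpart (Cong L) g))"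


section \<open>The classical integral of simple functions\<close>

text \<open>
  The library's Bochner integral requires both parts to have finite integral; here one suffices,
  and the value may be infinite.
\<close>

definition classical_integrable :: "'x measure \<Rightarrow> ('x \<Rightarrow> real) \<Rightarrow> bool" where
  "classical_integrable M f \<longleftrightarrow>
     simple_function M f \<and>
     (integral\<^sup>S M (\<lambda>x. ennreal (max (f x) 0)) < \<infinity> \<or>
      integral\<^sup>S M (\<lambda>x. ennreal (max (- f x) 0)) < \<infinity>)"

definition classical_integral :: "'x measure \<Rightarrow> ('x \<Rightarrow> real) \<Rightarrow> ereal" where
  "classical_integral M f =
     enn2ereal (integral\<^sup>S M (\<lambda>x. ennreal (max (f x) 0))) -
     enn2ereal (integral\<^sup>S M (\<lambda>x. ennreal (max (- f x) 0)))"

definition localic_counterpart :: "'x measure \<Rightarrow> ('x \<Rightarrow> real) \<Rightarrow> lreal \<Rightarrow> 'x set" where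
  "localic_counterpart M f = from_gens (sets_frame M)
     (\<lambda>p. f -` {of_rat p<..} \<inter> space M) (\<lambda>q. f -` {..<of_rat q} \<inter> space M)"

end

theory Submission
  imports Defs
begin

text \<open>
  Evaluating terms at points of the real line maps the sigma-frame of reals to open subsets of the
  line. Hence every measurable \<open>g\<close> induces the homomorphism \<open>t \<mapsto> g -` points t\<close>, and the localic
  operations on such homomorphisms, or on their images under \<open>\<nabla>\<close>, are the pointwise operations
  on functions.

  A congruence on a sigma-algebra is determined by the sigma-ideal of sets that it identifies with
  the empty set. A pair of complementary congruences therefore splits the space into two
  measurable pieces, so every complemented congruence is some \<open>\<nabla>\<^sub>A\<close>. Canonical forms over
  the congruence frame are thus canonical forms of classical simple functions, on which the two
  integrals agree term by term.
\<close>

text \<open>\<open>from_gens\<close> is a definite description and says nothing until a homomorphism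
  with the prescribed generator values is exhibited. Verifying the relations of the reals for sums,
  suprema and multiples in an abstract frame is avoided: the homomorphism required is always the
  preimage map of the pointwise result, and only equations between measurable sets remain.

  The integral is a description too, ranging over all canonical forms, so each of them has to be
  evaluated, whatever complemented congruences are its pieces. This is what forces the
  classification of complemented congruences. It rests on complements in the sigma-algebra: meeting
  a related pair with the complement of one side leaves a difference related to the empty set, which
  also gives binary joins of congruences an explicit form.

  The given \<open>A i\<close> need not yield a canonical form: some may be empty, and passing to
  the positive or negative part can send several coefficients to 0. Canonical forms are therefore
  built from level sets.\<close>

lemma bottom_eq_sup: "\<bottom>\<^bsub>L\<^esub> = \<Squnion>\<^bsub>L\<^esub> {}"
  by (simp add: bottom_def sup_def)

text \<open>The library picks joins by choice among least upper bounds; antisymmetry up to equality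
  leaves one candidate. Exhibiting a least bound thus determines a join in a mere partial
  order.\<close>

lemma sup_eqI:
  assumes "partial_order L" "A \<subseteq> carrier L" "s \<in> carrier L"
    and "\<And>x. x \<in> A \<Longrightarrow> x \<sqsubseteq>\<^bsub>L\<^esub> s"
    and "\<And>y. \<lbrakk>y \<in> carrier L; \<And>x. x \<in> A \<Longrightarrow> x \<sqsubseteq>\<^bsub>L\<^esub> y\<rbrakk> \<Longrightarrow> s \<sqsubseteq>\<^bsub>L\<^esub> y"
  shows "\<Squnion>\<^bsub>L\<^esub> A = s"
proof -
  have "is_lub L s A"
    using assms by (auto simp: least_def Upper_def subset_eq)
  then show ?thesis
    unfolding sup_def
    using partial_order.least_unique[OF assms(1)] by blast
qed

lemma inf_eqI:
  assumes "partial_order L" "A \<subseteq> carrier L" "s \<in> carrier L"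
    and "\<And>x. x \<in> A \<Longrightarrow> s \<sqsubseteq>\<^bsub>L\<^esub> x"
    and "\<And>y. \<lbrakk>y \<in> carrier L; \<And>x. x \<in> A \<Longrightarrow> y \<sqsubseteq>\<^bsub>L\<^esub> x\<rbrakk> \<Longrightarrow> y \<sqsubseteq>\<^bsub>L\<^esub> s"
  shows "\<Sqinter>\<^bsub>L\<^esub> A = s"
  using sup_eqI[OF partial_order.dual_order[OF assms(1)], of A s] assms(2-) by simp

lemma top_eqI:
  assumes "partial_order L" "s \<in> carrier L" "\<And>x. x \<in> carrier L \<Longrightarrow> x \<sqsubseteq>\<^bsub>L\<^esub> s"
  shows "\<top>\<^bsub>L\<^esub> = s"
proof -
  have "\<top>\<^bsub>L\<^esub> = \<Sqinter>\<^bsub>L\<^esub> {}"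
    by (simp add: top_def inf_def)
  then show ?thesis
    using inf_eqI[of L "{}" s] assms by simp
qed

lemma meet_eqI:
  assumes "partial_order L" "x \<in> carrier L" "y \<in> carrier L" "s \<in> carrier L"
    and "s \<sqsubseteq>\<^bsub>L\<^esub> x" "s \<sqsubseteq>\<^bsub>L\<^esub> y"
    and "\<And>z. \<lbrakk>z \<in> carrier L; z \<sqsubseteq>\<^bsub>L\<^esub> x; z \<sqsubseteq>\<^bsub>L\<^esub> y\<rbrakk> \<Longrightarrow> z \<sqsubseteq>\<^bsub>L\<^esub> s"
  shows "x \<sqinter>\<^bsub>L\<^esub> y = s"
  unfolding meet_def by (rule inf_eqI) (use assms in auto)

lemma partial_order_eqI:
  assumes "\<And>x. x \<in> C \<Longrightarrow> R x x"
    and "\<And>x y. \<lbrakk>x \<in> C; y \<in> C; R x y; R y x\<rbrakk> \<Longrightarrow> x = y"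
    and "\<And>x y z. \<lbrakk>x \<in> C; y \<in> C; z \<in> C; R x y; R y z\<rbrakk> \<Longrightarrow> R x z"
  shows "partial_order \<lparr>carrier = C, eq = (=), le = R\<rparr>"
  (is "partial_order ?L")
proof unfold_locales
  show "x \<sqsubseteq>\<^bsub>?L\<^esub> x" if "x \<in> carrier ?L" for x
    using that assms(1) by simp
  show "x .=\<^bsub>?L\<^esub> y" if "x \<sqsubseteq>\<^bsub>?L\<^esub> y" "y \<sqsubseteq>\<^bsub>?L\<^esub> x" "x \<in> carrier ?L" "y \<in> carrier ?L" for x y
    using that assms(2)[of x y] by simp
  show "x \<sqsubseteq>\<^bsub>?L\<^esub> z"
    if "x \<sqsubseteq>\<^bsub>?L\<^esub> y" "y \<sqsubseteq>\<^bsub>?L\<^esub> z" "x \<in> carrier ?L" "y \<in> carrier ?L" "z \<in> carrier ?L" for x y z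
    using that assms(3)[of x y z] by simp
qed simp_all

section \<open>Sigma-frame homomorphisms\<close>

lemma sigma_frame_homI:
  assumes "\<And>x. x \<in> carrier L \<Longrightarrow> h x \<in> carrier N" "h \<top>\<^bsub>L\<^esub> = \<top>\<^bsub>N\<^esub>"
    and "\<And>x y. \<lbrakk>x \<in> carrier L; y \<in> carrier L\<rbrakk> \<Longrightarrow> h (x \<sqinter>\<^bsub>L\<^esub> y) = h x \<sqinter>\<^bsub>N\<^esub> h y"
    and "\<And>C. \<lbrakk>C \<subseteq> carrier L; countable C\<rbrakk> \<Longrightarrow> h (\<Squnion>\<^bsub>L\<^esub> C) = \<Squnion>\<^bsub>N\<^esub> (h ` C)"
  shows "sigma_frame_hom L N h"
  unfolding sigma_frame_hom_def
  by (intro conjI funcsetI ballI allI impI; (elim conjE)?; rule assms)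

context
  fixes L :: "'a gorder" and N :: "'b gorder" and h
  assumes hom: "sigma_frame_hom L N h"
begin

lemma sigma_frame_hom_closed: "x \<in> carrier L \<Longrightarrow> h x \<in> carrier N"
  using hom by (simp add: sigma_frame_hom_def Pi_iff)

lemma sigma_frame_hom_top: "h \<top>\<^bsub>L\<^esub> = \<top>\<^bsub>N\<^esub>"
  using hom by (simp add: sigma_frame_hom_def Pi_iff)

lemma sigma_frame_hom_meet:
  "\<lbrakk>x \<in> carrier L; y \<in> carrier L\<rbrakk> \<Longrightarrow> h (x \<sqinter>\<^bsub>L\<^esub> y) = h x \<sqinter>\<^bsub>N\<^esub> h y"
  using hom by (simp add: sigma_frame_hom_def Pi_iff)

lemma sigma_frame_hom_sup:
  "\<lbrakk>C \<subseteq> carrier L; countable C\<rbrakk> \<Longrightarrow> h (\<Squnion>\<^bsub>L\<^esub> C) = \<Squnion>\<^bsub>N\<^esub> (h ` C)"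
  using hom by (simp add: sigma_frame_hom_def Pi_iff)

lemma sigma_frame_hom_join:
  "\<lbrakk>x \<in> carrier L; y \<in> carrier L\<rbrakk> \<Longrightarrow> h (x \<squnion>\<^bsub>L\<^esub> y) = h x \<squnion>\<^bsub>N\<^esub> h y"
  using sigma_frame_hom_sup[of "{x, y}"] by (simp add: join_def)

lemma sigma_frame_hom_bottom: "h \<bottom>\<^bsub>L\<^esub> = \<bottom>\<^bsub>N\<^esub>"
  using sigma_frame_hom_sup[of "{}"] by (simp add: bottom_eq_sup)

end

lemma sigma_frame_hom_comp:
  assumes g: "sigma_frame_hom K L g" and h: "sigma_frame_hom L N h"
  shows "sigma_frame_hom K N (h \<circ> g)"
proof (rule sigma_frame_homI)
  show "(h \<circ> g) (\<Squnion>\<^bsub>K\<^esub> C) = \<Squnion>\<^bsub>N\<^esub> ((h \<circ> g) ` C)"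
    if "C \<subseteq> carrier K" "countable C" for C
  proof -
    have "g ` C \<subseteq> carrier L"
      using sigma_frame_hom_closed[OF g] that by blast
    then show ?thesis
      using that by (simp add: sigma_frame_hom_sup[OF g] sigma_frame_hom_sup[OF h] image_comp)
  qed
qed (simp_all add: sigma_frame_hom_closed[OF g] sigma_frame_hom_closed[OF h]
  sigma_frame_hom_top[OF g] sigma_frame_hom_top[OF h]
  sigma_frame_hom_meet[OF g] sigma_frame_hom_meet[OF h])

section \<open>Measurable sets as a sigma-frame\<close>

lemma partial_order_sets_frame: "partial_order (sets_frame M)"
  unfolding sets_frame_def by (rule partial_order_eqI) auto

lemma carrier_sets_frame [simp]: "carrier (sets_frame M) = sets M"
  and le_sets_frame [simp]: "a \<sqsubseteq>\<^bsub>sets_frame M\<^esub> b \<longleftrightarrow> a \<subseteq> b"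
  by (simp_all add: sets_frame_def)

lemma top_sets_frame [simp]: "\<top>\<^bsub>sets_frame M\<^esub> = space M"
  by (rule top_eqI) (auto simp: partial_order_sets_frame sets.sets_into_space)

lemma meet_sets_frame [simp]:
  "\<lbrakk>a \<in> sets M; b \<in> sets M\<rbrakk> \<Longrightarrow> a \<sqinter>\<^bsub>sets_frame M\<^esub> b = a \<inter> b"
  by (rule meet_eqI) (auto simp: partial_order_sets_frame)

lemma sup_sets_frame [simp]:
  "\<lbrakk>C \<subseteq> sets M; countable C\<rbrakk> \<Longrightarrow> \<Squnion>\<^bsub>sets_frame M\<^esub> C = \<Union> C"
  by (rule sup_eqI) (auto simp: partial_order_sets_frame intro: sets.countable_Union)

lemma join_sets_frame [simp]:
  "\<lbrakk>a \<in> sets M; b \<in> sets M\<rbrakk> \<Longrightarrow> a \<squnion>\<^bsub>sets_frame M\<^esub> b = a \<union> b"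
  by (simp add: join_def)

lemma bottom_sets_frame [simp]: "\<bottom>\<^bsub>sets_frame M\<^esub> = {}"
  by (simp add: bottom_eq_sup)

section \<open>Points of the sigma-frame of reals\<close>

lemma partial_order_LR: "partial_order LR"
  unfolding LR_def
proof (rule partial_order_eqI)
  fix x y z :: lreal
  show "lreal_le x x" by transfer (rule rle_refl)
  show "lreal_le x y \<Longrightarrow> lreal_le y x \<Longrightarrow> x = y" by transfer simp
  show "lreal_le x y \<Longrightarrow> lreal_le y z \<Longrightarrow> lreal_le x z" by transfer (rule rle_trans)
qed

lemma carrier_LR [simp]: "carrier LR = UNIV"
  by (simp add: LR_def)

lemma le_LR_abs [simp]: "abs_lreal s \<sqsubseteq>\<^bsub>LR\<^esub> abs_lreal t \<longleftrightarrow> rle s t"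
  by (simp add: LR_def lreal_le.abs_eq)

lemma abs_rep_lreal [simp]: "abs_lreal (rep_lreal x) = x"
  by (rule Quotient_abs_rep[OF Quotient_lreal])

lemma abs_lreal_cases: obtains s where "x = abs_lreal s"
  by (metis abs_rep_lreal)

lemma top_LR: "\<top>\<^bsub>LR\<^esub> = abs_lreal RTop"
proof (rule top_eqI[OF partial_order_LR])
  show "x \<sqsubseteq>\<^bsub>LR\<^esub> abs_lreal RTop" for x
    by (cases x rule: abs_lreal_cases) (simp add: rle_top)
qed simp

lemma meet_LR: "abs_lreal s \<sqinter>\<^bsub>LR\<^esub> abs_lreal t = abs_lreal (RMeet s t)"
proof (rule meet_eqI[OF partial_order_LR])
  show "z \<sqsubseteq>\<^bsub>LR\<^esub> abs_lreal (RMeet s t)"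
    if "z \<sqsubseteq>\<^bsub>LR\<^esub> abs_lreal s" "z \<sqsubseteq>\<^bsub>LR\<^esub> abs_lreal t" for z
    using that by (cases z rule: abs_lreal_cases) (simp add: rle_meetI)
qed (auto intro: rle_meet1 rle_meet2)

text \<open>By \<open>rle_joinI\<close> and \<open>rle_joinE\<close>, a formal join is a least upper
  bound of its members. Together with \<open>top_LR\<close> and \<open>meet_LR\<close> this lets
  homomorphisms be evaluated by recursion on terms.\<close>

lemma sup_LR: "\<Squnion>\<^bsub>LR\<^esub> (abs_lreal ` rcset C) = abs_lreal (RJoin C)"
proof (rule sup_eqI[OF partial_order_LR])
  show "abs_lreal (RJoin C) \<sqsubseteq>\<^bsub>LR\<^esub> y"
    if y: "\<And>x. x \<in> abs_lreal ` rcset C \<Longrightarrow> x \<sqsubseteq>\<^bsub>LR\<^esub> y" for y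
  proof (cases y rule: abs_lreal_cases)
    case (1 s)
    have "rle t s" if "t \<in> rcset C" for t
      using y[of "abs_lreal t"] that 1 by simp
    then show ?thesis
      by (simp add: 1 rle_joinE)
  qed
qed (auto intro: rle_joinI)

text \<open>Every class is represented by a term built from generators with operations that
  homomorphisms preserve. This is the uniqueness half of the description in
  \<open>from_gens\<close>, valid for any target.\<close>

lemma MF_gens_unique:
  assumes "h \<in> MF N" "k \<in> MF N"
    and gt: "\<And>p. h (gt p) = k (gt p)" and lt: "\<And>q. h (lt q) = k (lt q)"
  shows "h = k"
proof
  have h: "sigma_frame_hom LR N h" and k: "sigma_frame_hom LR N k"
    using assms by (simp_all add: MF_def)
  have "h (abs_lreal s) = k (abs_lreal s)" for s
  proof (induction s)
    case (RGt p) then show ?case using gt by (simp add: gt.abs_eq)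
  next
    case (RLt q) then show ?case using lt by (simp add: lt.abs_eq)
  next
    case RTop
    show ?case
      by (simp add: sigma_frame_hom_top[OF h] sigma_frame_hom_top[OF k] flip: top_LR)
  next
    case (RMeet s t)
    then show ?case
      by (simp add: sigma_frame_hom_meet[OF h] sigma_frame_hom_meet[OF k] flip: meet_LR)
  next
    case (RJoin C)
    have "h ` abs_lreal ` rcset C = k ` abs_lreal ` rcset C"
      using RJoin by (auto simp: image_image intro!: image_cong)
    moreover have "countable (abs_lreal ` rcset C)" by simp
    ultimately show ?case using h k
      unfolding MF_def sigma_frame_hom_def mem_Collect_eq sup_LR[symmetric] carrier_LR
      by (metis subset_UNIV)
  qed
  then show "h x = k x" for x
    by (cases x rule: abs_lreal_cases) simp
qed

lemma from_gens_eq: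
  assumes "h \<in> MF N" "\<And>p. h (gt p) = u p" "\<And>q. h (lt q) = l q"
  shows "from_gens N u l = h"
  unfolding from_gens_def
  by (rule the_equality) (use assms in \<open>auto intro: MF_gens_unique\<close>)

section \<open>The real line as a model of the presentation\<close>

primrec rterm_points :: "rterm \<Rightarrow> real set" where
  "rterm_points (RGt p) = {of_rat p<..}"
| "rterm_points (RLt q) = {..<of_rat q}"
| "rterm_points RTop = UNIV"
| "rterm_points (RMeet s t) = rterm_points s \<inter> rterm_points t"
| "rterm_points (RJoin C) = \<Union> (rcset (cimage rterm_points C))"

lemma rcset_cimage: "rcset (cimage f C) = f ` rcset C"
  by (rule cimage.rep_eq)

text \<open>\<open>acset\<close> inverts \<open>rcset\<close> only on countable sets; indexing by
  \<open>rat\<close> ensures countability.\<close>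

lemma rcset_acset_rat [simp]: "rcset (acset {f r |r :: rat. P r}) = {f r |r. P r}"
  by (rule acset_inverse) (simp add: setcompr_eq_image)

lemma rcset_acset_range [simp]: "rcset (acset (range (f :: rat \<Rightarrow> _))) = range f"
  by (rule acset_inverse) simp

lemma rcset_acset_pair [simp]: "rcset (acset {x, y}) = {x, y}"
  by (rule acset_inverse) simp

lemma rcset_cempty [simp]: "rcset cempty = {}"
  by (rule bot_cset.rep_eq)

text \<open>Soundness of the calculus on the line. Density of the rationals in the reals gives
  \<open>rle_Gt1\<close> and \<open>rle_Lt1\<close>; combined with the absence of endpoints it gives
  \<open>rle_all_Gt\<close> and \<open>rle_all_Lt\<close>.\<close>

lemma rterm_points_mono: "rle s t \<Longrightarrow> rterm_points s \<subseteq> rterm_points t"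
proof (induction rule: rle.induct)
  case (rle_cover p q)
  then have "(of_rat p :: real) < of_rat q" by (simp add: of_rat_less)
  then show ?case by (auto simp: rcset_cimage)
next
  case (rle_disjoint q p)
  then have "(of_rat q :: real) \<le> of_rat p" by (simp add: of_rat_less_eq)
  then show ?case by auto
next
  case (rle_Gt1 p)
  then show ?case
    by (auto simp: rcset_cimage of_rat_less) (metis greaterThan_iff of_rat_dense of_rat_less rterm_points.simps(1))
next
  case (rle_Gt2 p)
  then show ?case
    by (auto simp: rcset_cimage) (metis less_trans of_rat_less)
next
  case (rle_Lt1 q)
  then show ?case
    by (auto simp: rcset_cimage of_rat_less) (metis lessThan_iff of_rat_dense of_rat_less rterm_points.simps(2))
next
  case (rle_Lt2 q)
  then show ?case
    by (auto simp: rcset_cimage) (metis less_trans of_rat_less)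
next
  case rle_all_Gt
  show ?case by (auto simp: rcset_cimage) (metis lt_ex of_rat_dense)
next
  case rle_all_Lt
  show ?case by (auto simp: rcset_cimage) (metis gt_ex of_rat_dense)
qed (auto simp: rcset_cimage)

lemma open_rterm_points: "open (rterm_points s)"
  by (induction s) (auto simp: rcset_cimage)

lift_definition points :: "lreal \<Rightarrow> real set" is rterm_points
  by (blast dest: rterm_points_mono)

lemma points_gt [simp]: "points (gt p) = {of_rat p<..}"
  by transfer simp

lemma points_lt [simp]: "points (lt q) = {..<of_rat q}"
  by transfer simp

lemma open_points: "open (points t)"
  by transfer (rule open_rterm_points)

section \<open>Homomorphisms induced by measurable functions\<close>

definition preimage_hom :: "'x measure \<Rightarrow> ('x \<Rightarrow> real) \<Rightarrow> lreal \<Rightarrow> 'x set" where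
  "preimage_hom M g t = g -` points t \<inter> space M"

lemma preimage_hom_sets:
  "g \<in> borel_measurable M \<Longrightarrow> preimage_hom M g t \<in> sets M"
  unfolding preimage_hom_def by (rule measurable_sets[OF _ borel_open[OF open_points]])

lemma preimage_hom_MF:
  assumes g: "g \<in> borel_measurable M"
  shows "preimage_hom M g \<in> MF (sets_frame M)"
proof -
  have "preimage_hom M g (\<Squnion>\<^bsub>LR\<^esub> C) = \<Squnion>\<^bsub>sets_frame M\<^esub> (preimage_hom M g ` C)"
    if "countable C" for C
  proof -
    \<comment> \<open>\<open>sup_LR\<close> speaks of classes of a countable set of terms, so
      representatives are chosen for the members of \<open>C\<close>.\<close>
    define D where "D = acset (rep_lreal ` C)"
    have "rcset D = rep_lreal ` C"
      unfolding D_def by (rule acset_inverse) (simp add: that)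
    then have C: "C = abs_lreal ` rcset D"
      by (simp add: image_image)
    have "preimage_hom M g (\<Squnion>\<^bsub>LR\<^esub> C) = \<Union> (preimage_hom M g ` C)"
      unfolding C sup_LR by (auto simp: preimage_hom_def points.abs_eq rcset_cimage)
    also have "\<dots> = \<Squnion>\<^bsub>sets_frame M\<^esub> (preimage_hom M g ` C)"
      using that g by (subst sup_sets_frame) (auto simp: preimage_hom_sets)
    finally show ?thesis .
  qed
  moreover have "preimage_hom M g (x \<sqinter>\<^bsub>LR\<^esub> y) =
      preimage_hom M g x \<sqinter>\<^bsub>sets_frame M\<^esub> preimage_hom M g y" for x y
  proof -
    obtain s t where "x = abs_lreal s" "y = abs_lreal t"
      by (metis abs_lreal_cases)
    then show ?thesis
      \<comment> \<open>The meet is rewritten while \<open>preimage_hom\<close> is still folded, the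
        form in which measurability is known; only then is it unfolded.\<close>
      using g by (auto simp: preimage_hom_sets)
        (auto simp: preimage_hom_def meet_LR points.abs_eq)
  qed
  moreover have "preimage_hom M g \<top>\<^bsub>LR\<^esub> = \<top>\<^bsub>sets_frame M\<^esub>"
    by (simp add: preimage_hom_def top_LR points.abs_eq)
  ultimately show ?thesis
    unfolding MF_def using g by (auto intro: sigma_frame_homI simp: preimage_hom_sets)
qed

lemma preimage_hom_cong:
  "(\<And>x. x \<in> space M \<Longrightarrow> g x = h x) \<Longrightarrow> preimage_hom M g = preimage_hom M h"
  by (auto simp: preimage_hom_def fun_eq_iff)

lemma preimage_hom_gt: "preimage_hom M g (gt p) = {x \<in> space M. of_rat p < g x}"
  and preimage_hom_lt: "preimage_hom M g (lt q) = {x \<in> space M. g x < of_rat q}"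
  by (auto simp: preimage_hom_def)

text \<open>A rational strictly between two different values is detected by the generator
  \<open>gt p\<close>. This recovers a function on the space from its localic counterpart.\<close>

lemma preimage_hom_inject:
  assumes eq: "preimage_hom M g = preimage_hom M h" and x: "x \<in> space M"
  shows "g x = h x"
proof (rule ccontr)
  assume "g x \<noteq> h x"
  then obtain p where p: "g x < of_rat p \<and> of_rat p < h x \<or> h x < of_rat p \<and> of_rat p < g x"
    by (metis linorder_neqE of_rat_dense)
  have "x \<in> preimage_hom M g (gt p) \<longleftrightarrow> x \<in> preimage_hom M h (gt p)"
    by (simp add: eq)
  then show False
    using x p by (auto simp: preimage_hom_gt)
qed

text \<open>The set-level form of the join in \<open>mf_add\<close>; the witness is a rational
  strictly between \<open>of_rat p - h x\<close> and \<open>g x\<close>.\<close>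

lemma sum_gt_eq_UN:
  fixes g h :: "'x \<Rightarrow> real"
  shows "{x \<in> X. of_rat p < g x + h x} =
    (\<Union>t. {x \<in> X. of_rat t < g x} \<inter> {x \<in> X. of_rat (p - t) < h x})"
proof -
  have "\<exists>t. of_rat t < g x \<and> of_rat (p - t) < h x" if x: "of_rat p < g x + h x" for x
  proof -
    obtain t where "of_rat p - h x < of_rat t" "of_rat t < g x"
      using of_rat_dense[of "of_rat p - h x" "g x"] x by auto
    then show ?thesis
      by (auto simp: of_rat_diff intro!: exI[of _ t])
  qed
  then show ?thesis
    by (auto simp: of_rat_diff)
qed

lemma sum_lt_eq_UN:
  fixes g h :: "'x \<Rightarrow> real"
  shows "{x \<in> X. g x + h x < of_rat q} =
    (\<Union>t. {x \<in> X. g x < of_rat t} \<inter> {x \<in> X. h x < of_rat (q - t)})"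
proof -
  have "\<exists>t. g x < of_rat t \<and> h x < of_rat (q - t)" if x: "g x + h x < of_rat q" for x
  proof -
    obtain t where "g x < of_rat t" "of_rat t < of_rat q - h x"
      using of_rat_dense[of "g x" "of_rat q - h x"] x by auto
    then show ?thesis
      by (auto simp: of_rat_diff intro!: exI[of _ t])
  qed
  then show ?thesis
    by (auto simp: of_rat_diff)
qed

section \<open>Operations on images of measurable functions\<close>

text \<open>
  The instances are the identity and \<open>\<nabla>\<close>. Uniqueness of complements is an assumption because
  the target need not be distributive.
\<close>

locale complement_hom =
  fixes M :: "'x measure" and N :: "'b gorder" and \<phi> :: "'x set \<Rightarrow> 'b"
  assumes hom: "sigma_frame_hom (sets_frame M) N \<phi>"
    and complement_unique:
      "\<lbrakk>a \<in> sets M; is_complement N (\<phi> a) b\<rbrakk> \<Longrightarrow> b = \<phi> (space M - a)"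
begin

lemma phi_top: "\<phi> (space M) = \<top>\<^bsub>N\<^esub>"
  using sigma_frame_hom_top[OF hom] by simp

lemma phi_bottom: "\<phi> {} = \<bottom>\<^bsub>N\<^esub>"
  using sigma_frame_hom_bottom[OF hom] by simp

lemma phi_meet: "\<lbrakk>a \<in> sets M; b \<in> sets M\<rbrakk> \<Longrightarrow> \<phi> a \<sqinter>\<^bsub>N\<^esub> \<phi> b = \<phi> (a \<inter> b)"
  using sigma_frame_hom_meet[OF hom, of a b] by simp

lemma phi_join: "\<lbrakk>a \<in> sets M; b \<in> sets M\<rbrakk> \<Longrightarrow> \<phi> a \<squnion>\<^bsub>N\<^esub> \<phi> b = \<phi> (a \<union> b)"
  using sigma_frame_hom_join[OF hom, of a b] by simp

lemma phi_sup:
  "\<lbrakk>countable I; \<And>i. i \<in> I \<Longrightarrow> B i \<in> sets M\<rbrakk> \<Longrightarrow> \<Squnion>\<^bsub>N\<^esub> ((\<lambda>i. \<phi> (B i)) ` I) = \<phi> (\<Union>i\<in>I. B i)"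
  using sigma_frame_hom_sup[OF hom, of "B ` I"] by (simp add: image_subset_iff image_image)

lemma phi_closed: "a \<in> sets M \<Longrightarrow> \<phi> a \<in> carrier N"
  using sigma_frame_hom_closed[OF hom, of a] by simp

lemma is_complement_phi: "a \<in> sets M \<Longrightarrow> is_complement N (\<phi> a) (\<phi> (space M - a))"
  using sets.sets_into_space[of a M]
  by (auto simp: is_complement_def phi_closed phi_meet phi_join phi_bottom phi_top Un_absorb1)

lemma compl_phi: "a \<in> sets M \<Longrightarrow> compl N (\<phi> a) = \<phi> (space M - a)"
  unfolding compl_def using is_complement_phi complement_unique by (intro the_equality)

lemma complemented_phi: "a \<in> sets M \<Longrightarrow> complemented N (\<phi> a)"
  unfolding complemented_def using is_complement_phi by blast

lemma MF_phi: "g \<in> borel_measurable M \<Longrightarrow> \<phi> \<circ> preimage_hom M g \<in> MF N"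
  using sigma_frame_hom_comp[OF _ hom] preimage_hom_MF[of g M] by (simp add: MF_def)

text \<open>Reduces each operation to comparing sets at the generators, since
  \<open>\<phi> \<circ> preimage_hom M g\<close> is already known to be a homomorphism.\<close>

lemma from_gens_phi:
  assumes "g \<in> borel_measurable M"
    and "\<And>p. u p = \<phi> {x \<in> space M. of_rat p < g x}"
    and "\<And>q. l q = \<phi> {x \<in> space M. g x < of_rat q}"
  shows "from_gens N u l = \<phi> \<circ> preimage_hom M g"
  by (rule from_gens_eq) (simp_all add: assms MF_phi preimage_hom_gt preimage_hom_lt)

lemma mf_zero_phi: "mf_zero N = \<phi> \<circ> preimage_hom M (\<lambda>_. 0)"
  unfolding mf_zero_def by (rule from_gens_phi) (auto simp: phi_top phi_bottom)

lemma mf_neg_phi: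
  assumes [measurable]: "g \<in> borel_measurable M"
  shows "mf_neg N (\<phi> \<circ> preimage_hom M g) = \<phi> \<circ> preimage_hom M (\<lambda>x. - g x)"
  unfolding mf_neg_def
  by (rule from_gens_phi)
    (auto simp: preimage_hom_gt preimage_hom_lt of_rat_minus less_minus_iff minus_less_iff)

lemma mf_scale_pos_phi:
  assumes [measurable]: "g \<in> borel_measurable M" and c: "c > 0"
  shows "mf_scale_pos N c (\<phi> \<circ> preimage_hom M g) = \<phi> \<circ> preimage_hom M (\<lambda>x. of_rat c * g x)"
  unfolding mf_scale_pos_def using c
  by (intro from_gens_phi)
    (auto simp: preimage_hom_gt preimage_hom_lt of_rat_divide pos_divide_less_eq pos_less_divide_eq mult.commute)

lemma mf_scale_phi:
  assumes [measurable]: "g \<in> borel_measurable M"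
  shows "mf_scale N c (\<phi> \<circ> preimage_hom M g) = \<phi> \<circ> preimage_hom M (\<lambda>x. of_rat c * g x)"
  unfolding mf_scale_def
  by (auto simp: mf_scale_pos_phi mf_neg_phi mf_zero_phi of_rat_minus)

lemma mf_add_phi:
  assumes [measurable]: "g \<in> borel_measurable M" "h \<in> borel_measurable M"
  shows "mf_add N (\<phi> \<circ> preimage_hom M g) (\<phi> \<circ> preimage_hom M h) =
    \<phi> \<circ> preimage_hom M (\<lambda>x. g x + h x)"
  unfolding mf_add_def
proof (rule from_gens_phi)
  show "\<Squnion>\<^bsub>N\<^esub> (range (\<lambda>t. (\<phi> \<circ> preimage_hom M g) (gt t) \<sqinter>\<^bsub>N\<^esub> (\<phi> \<circ> preimage_hom M h) (gt (p - t)))) =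
      \<phi> {x \<in> space M. of_rat p < g x + h x}" for p
    by (simp add: phi_meet phi_sup preimage_hom_gt sum_gt_eq_UN)
  show "\<Squnion>\<^bsub>N\<^esub> (range (\<lambda>t. (\<phi> \<circ> preimage_hom M g) (lt t) \<sqinter>\<^bsub>N\<^esub> (\<phi> \<circ> preimage_hom M h) (lt (q - t)))) =
      \<phi> {x \<in> space M. g x + h x < of_rat q}" for q
    by (simp add: phi_meet phi_sup preimage_hom_lt sum_lt_eq_UN)
qed simp

lemma mf_sup_phi:
  assumes [measurable]: "g \<in> borel_measurable M" "h \<in> borel_measurable M"
  shows "mf_sup N (\<phi> \<circ> preimage_hom M g) (\<phi> \<circ> preimage_hom M h) =
    \<phi> \<circ> preimage_hom M (\<lambda>x. max (g x) (h x))"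
  unfolding mf_sup_def
  by (rule from_gens_phi)
    (auto simp: preimage_hom_gt preimage_hom_lt phi_meet phi_join less_max_iff_disj
      intro!: arg_cong[where f = \<phi>])

lemma mf_pos_phi:
  "g \<in> borel_measurable M \<Longrightarrow>
    mf_pos N (\<phi> \<circ> preimage_hom M g) = \<phi> \<circ> preimage_hom M (\<lambda>x. max (g x) 0)"
  by (simp add: mf_pos_def mf_zero_phi mf_sup_phi)

lemma mf_negpart_phi:
  "g \<in> borel_measurable M \<Longrightarrow>
    mf_negpart N (\<phi> \<circ> preimage_hom M g) = \<phi> \<circ> preimage_hom M (\<lambda>x. max (- g x) 0)"
  by (simp add: mf_negpart_def mf_zero_phi mf_neg_phi mf_sup_phi)

text \<open>Among the operations on localic functions, this one has \<open>compl\<close> in its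
  generator values; uniqueness of complements enters here through \<open>compl_phi\<close>.\<close>

lemma chi_phi:
  assumes [measurable]: "a \<in> sets M"
  shows "chi N (\<phi> a) = \<phi> \<circ> preimage_hom M (indicator a)"
  unfolding chi_def
proof (rule from_gens_phi)
  have a: "{x \<in> space M. x \<in> a} = a" "{x \<in> space M. x \<notin> a} = space M - a"
    using sets.sets_into_space[OF assms] by auto
  show "(if p < 0 then \<top>\<^bsub>N\<^esub> else if p < 1 then \<phi> a else \<bottom>\<^bsub>N\<^esub>) =
      \<phi> {x \<in> space M. of_rat p < (indicator a x :: real)}" for p
  proof -
    have "{x \<in> space M. of_rat p < (indicator a x :: real)} =
      (if p < 0 then space M else if p < 1 then {x \<in> space M. x \<in> a} else {})"
      by (auto simp: indicator_def of_rat_less_1_iff split: if_splits)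
    then show ?thesis by (simp add: a phi_top phi_bottom)
  qed
  show "(if q \<le> 0 then \<bottom>\<^bsub>N\<^esub> else if q \<le> 1 then compl N (\<phi> a) else \<top>\<^bsub>N\<^esub>) =
      \<phi> {x \<in> space M. (indicator a x :: real) < of_rat q}" for q
  proof -
    have "{x \<in> space M. (indicator a x :: real) < of_rat q} =
      (if q \<le> 0 then {} else if q \<le> 1 then {x \<in> space M. x \<notin> a} else space M)"
      by (auto simp: indicator_def split: if_splits)
    then show ?thesis by (simp add: a phi_top phi_bottom compl_phi)
  qed
qed simp

text \<open>The sum is evaluated pointwise, one summand at a time. The assumptions are confined to
  \<open>{1..n}\<close> because a canonical form says nothing about \<open>a\<close> at other
  indices.\<close>

lemma simple_sum_phi:
  assumes "\<And>i. i \<in> {1..n} \<Longrightarrow> a i = \<phi> (B i)" and "\<And>i. i \<in> {1..n} \<Longrightarrow> B i \<in> sets M"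
  shows "simple_sum N n r a = \<phi> \<circ> preimage_hom M (\<lambda>x. \<Sum>i = 1..n. of_rat (r i) * indicator (B i) x)"
  using assms
proof (induction n)
  case 0
  show ?case by (simp add: mf_zero_phi)
next
  case (Suc n)
  have [measurable]: "B i \<in> sets M" if "i \<in> {1..Suc n}" for i
    using Suc.prems(2) that .
  let ?g = "\<lambda>x. \<Sum>i = 1..n. of_rat (r i) * indicator (B i) x :: real"
  have [measurable]: "?g \<in> borel_measurable M"
    by (intro borel_measurable_sum) simp
  have "simple_sum N (Suc n) r a =
      mf_add N (\<phi> \<circ> preimage_hom M ?g) (mf_scale N (r (Suc n)) (chi N (\<phi> (B (Suc n)))))"
    \<comment> \<open>\<open>sum_mult_indicator\<close> turns such a sum into one over a filtered
      index set; deleting it keeps the sum in the form of \<open>?g\<close>.\<close>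
    using Suc.IH Suc.prems by (simp add: comp_def del: sum_mult_indicator)
  also have "\<dots> = \<phi> \<circ> preimage_hom M (\<lambda>x. ?g x + of_rat (r (Suc n)) * indicator (B (Suc n)) x)"
    by (subst chi_phi, measurable)+ (subst mf_scale_phi mf_add_phi; measurable)+
  finally show ?case
    by simp
qed

end

lemma localic_counterpart_eq:
  "g \<in> borel_measurable M \<Longrightarrow> localic_counterpart M g = preimage_hom M g"
  unfolding localic_counterpart_def
  by (rule from_gens_eq) (auto simp: preimage_hom_MF, auto simp: preimage_hom_def)


section \<open>Congruences on a sigma-algebra\<close>

lemma carrier_Cong [simp]: "\<theta> \<in> carrier (Cong L) \<longleftrightarrow> congruence L \<theta>"
  and le_Cong [simp]: "\<theta> \<sqsubseteq>\<^bsub>Cong L\<^esub> \<eta> \<longleftrightarrow> \<theta> \<subseteq> \<eta>"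
  by (simp_all add: Cong_def)

lemma partial_order_Cong: "partial_order (Cong L)"
  unfolding Cong_def by (rule partial_order_eqI) auto

lemma congruenceI:
  assumes "\<And>x y. (x, y) \<in> \<theta> \<Longrightarrow> x \<in> sets M \<and> y \<in> sets M"
    and "\<And>x. x \<in> sets M \<Longrightarrow> (x, x) \<in> \<theta>"
    and "\<And>x y. (x, y) \<in> \<theta> \<Longrightarrow> (y, x) \<in> \<theta>"
    and "\<And>x y z. (x, y) \<in> \<theta> \<Longrightarrow> (y, z) \<in> \<theta> \<Longrightarrow> (x, z) \<in> \<theta>"
    and "\<And>x x' y y'. (x, x') \<in> \<theta> \<Longrightarrow> (y, y') \<in> \<theta> \<Longrightarrow> (x \<inter> y, x' \<inter> y') \<in> \<theta>"
    and "\<And>C. C \<subseteq> \<theta> \<Longrightarrow> countable C \<Longrightarrow> (\<Union> (fst ` C), \<Union> (snd ` C)) \<in> \<theta>"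
  shows "congruence (sets_frame M) \<theta>"
  unfolding congruence_def
proof (intro conjI allI impI)
  show "equiv (carrier (sets_frame M)) \<theta>"
    by (rule equivI; (rule refl_onI | rule symI | rule transI)?) (auto dest: assms(1) intro: assms(2-4))
  show "(x \<sqinter>\<^bsub>sets_frame M\<^esub> y, x' \<sqinter>\<^bsub>sets_frame M\<^esub> y') \<in> \<theta>"
    if "(x, x') \<in> \<theta> \<and> (y, y') \<in> \<theta>" for x x' y y'
    using that assms(1)[of x x'] assms(1)[of y y'] assms(5) by simp
  show "(\<Squnion>\<^bsub>sets_frame M\<^esub> (fst ` C), \<Squnion>\<^bsub>sets_frame M\<^esub> (snd ` C)) \<in> \<theta>"
    if C: "C \<subseteq> \<theta> \<and> countable C" for C
  proof -
    have "fst ` C \<subseteq> sets M" "snd ` C \<subseteq> sets M"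
      using C assms(1) by force+
    then show ?thesis
      using C assms(6) by simp
  qed
qed

context
  fixes M :: "'x measure" and \<theta>
  assumes \<theta>: "congruence (sets_frame M) \<theta>"
begin

lemma congruence_sets: "(x, y) \<in> \<theta> \<Longrightarrow> x \<in> sets M" "(x, y) \<in> \<theta> \<Longrightarrow> y \<in> sets M"
  using \<theta> by (auto simp: congruence_def equiv_def)

lemma congruence_refl: "x \<in> sets M \<Longrightarrow> (x, x) \<in> \<theta>"
  using \<theta> by (auto simp: congruence_def equiv_def refl_on_def)

lemma congruence_sym: "(x, y) \<in> \<theta> \<Longrightarrow> (y, x) \<in> \<theta>"
  using \<theta> by (auto simp: congruence_def equiv_def dest: symD)

lemma congruence_trans: "(x, y) \<in> \<theta> \<Longrightarrow> (y, z) \<in> \<theta> \<Longrightarrow> (x, z) \<in> \<theta>"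
  using \<theta> by (auto simp: congruence_def equiv_def dest: transD)

lemma congruence_Int:
  assumes "(x, x') \<in> \<theta>" "(y, y') \<in> \<theta>"
  shows "(x \<inter> y, x' \<inter> y') \<in> \<theta>"
proof -
  have "(x \<sqinter>\<^bsub>sets_frame M\<^esub> y, x' \<sqinter>\<^bsub>sets_frame M\<^esub> y') \<in> \<theta>"
    using \<theta> assms unfolding congruence_def by blast
  then show ?thesis
    using assms by (simp add: congruence_sets)
qed

lemma congruence_Union:
  assumes "C \<subseteq> \<theta>" "countable C"
  shows "(\<Union> (fst ` C), \<Union> (snd ` C)) \<in> \<theta>"
proof -
  have "fst ` C \<subseteq> sets M" "snd ` C \<subseteq> sets M"
    using assms(1) congruence_sets by force+
  moreover have "(\<Squnion>\<^bsub>sets_frame M\<^esub> (fst ` C), \<Squnion>\<^bsub>sets_frame M\<^esub> (snd ` C)) \<in> \<theta>"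
    using \<theta> assms unfolding congruence_def by blast
  ultimately show ?thesis
    using assms(2) by simp
qed

lemma congruence_Un:
  "(x, x') \<in> \<theta> \<Longrightarrow> (y, y') \<in> \<theta> \<Longrightarrow> (x \<union> y, x' \<union> y') \<in> \<theta>"
  using congruence_Union[of "{(x, x'), (y, y')}"] by simp

lemma congruence_UN_empty:
  assumes "countable I" "\<And>i. i \<in> I \<Longrightarrow> (u i, {}) \<in> \<theta>"
  shows "((\<Union>i\<in>I. u i), {}) \<in> \<theta>"
  using congruence_Union[of "(\<lambda>i. (u i, {})) ` I"] assms by (simp add: image_image image_subset_iff)

text \<open>Meeting the pair with the complement of \<open>y\<close> relates \<open>x - y\<close> to
  the empty set, and symmetrically for \<open>y - x\<close>. Related sets thus differ by a collapsed
  set.\<close>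

lemma congruence_symmetric_difference:
  assumes "(x, y) \<in> \<theta>"
  shows "((x - y) \<union> (y - x), {}) \<in> \<theta>"
proof -
  have sets: "x \<in> sets M" "y \<in> sets M"
    using assms congruence_sets by auto
  have "(x \<inter> (space M - y), y \<inter> (space M - y)) \<in> \<theta>" "(y \<inter> (space M - x), x \<inter> (space M - x)) \<in> \<theta>"
    using congruence_Int[OF assms congruence_refl[of "space M - y"]]
      congruence_Int[OF congruence_sym[OF assms] congruence_refl[of "space M - x"]] sets
    by simp_all
  moreover have "x \<inter> (space M - y) = x - y" "y \<inter> (space M - x) = y - x"
    using sets sets.sets_into_space by blast+
  moreover have "y \<inter> (space M - y) = {}" "x \<inter> (space M - x) = {}"
    by auto
  ultimately show ?thesis
    using congruence_Un[of "x - y" "{}" "y - x" "{}"] by simp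
qed

text \<open>The converse passage, from collapsed sets to related pairs: \<open>x\<close> is related
  to \<open>x \<union> u\<close>, which equals \<open>y \<union> u\<close>, which is related to
  \<open>y\<close>.\<close>

lemma congruence_of_Un_eq:
  assumes "x \<in> sets M" "y \<in> sets M" "(u, {}) \<in> \<theta>" "x \<union> u = y \<union> u"
  shows "(x, y) \<in> \<theta>"
proof -
  have "(x \<union> u, x) \<in> \<theta>" "(y \<union> u, y) \<in> \<theta>"
    using congruence_Un[OF congruence_refl assms(3)] assms(1,2) by force+
  then show ?thesis
    using assms(4) congruence_sym congruence_trans by metis
qed

end

section \<open>Congruences generated by one measurable set\<close>

lemma mem_nabla:
  "u \<in> sets M \<Longrightarrow> (x, y) \<in> nabla (sets_frame M) u \<longleftrightarrow> x \<in> sets M \<and> y \<in> sets M \<and> x \<union> u = y \<union> u"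
  by (auto simp: nabla_def)

lemma congruence_nabla:
  assumes u: "u \<in> sets M"
  shows "congruence (sets_frame M) (nabla (sets_frame M) u)"
proof (rule congruenceI)
  fix C assume C: "C \<subseteq> nabla (sets_frame M) u" "countable C"
  have *: "fst z \<in> sets M \<and> snd z \<in> sets M \<and> fst z \<union> u = snd z \<union> u" if "z \<in> C" for z
    using mem_nabla[OF u, of "fst z" "snd z"] C(1) that by auto
  then have "\<Union> (fst ` C) \<union> u = \<Union> (snd ` C) \<union> u"
    by blast
  moreover have "\<Union> (fst ` C) \<in> sets M" "\<Union> (snd ` C) \<in> sets M"
    using * C(2) by (auto intro!: sets.countable_Union)
  ultimately show "(\<Union> (fst ` C), \<Union> (snd ` C)) \<in> nabla (sets_frame M) u"
    using u by (simp add: mem_nabla)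
qed (use u in \<open>auto simp: mem_nabla\<close>)

text \<open>Identifies \<open>nabla\<close> of \<open>u\<close> as the least congruence that
  collapses \<open>u\<close>, so inclusions are tested on a single pair.\<close>

lemma nabla_subset_iff:
  assumes "u \<in> sets M" "congruence (sets_frame M) \<theta>"
  shows "nabla (sets_frame M) u \<subseteq> \<theta> \<longleftrightarrow> (u, {}) \<in> \<theta>"
proof
  have "(u, {}) \<in> nabla (sets_frame M) u"
    using assms by (simp add: mem_nabla)
  then show "nabla (sets_frame M) u \<subseteq> \<theta> \<Longrightarrow> (u, {}) \<in> \<theta>"
    by blast
  show "nabla (sets_frame M) u \<subseteq> \<theta>" if "(u, {}) \<in> \<theta>"
    using that assms congruence_of_Un_eq[OF assms(2)] by (auto simp: mem_nabla)
qed

lemma nabla_subset_nabla_iff: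
  "\<lbrakk>u \<in> sets M; v \<in> sets M\<rbrakk> \<Longrightarrow> nabla (sets_frame M) u \<subseteq> nabla (sets_frame M) v \<longleftrightarrow> u \<subseteq> v"
  by (auto simp: nabla_subset_iff congruence_nabla mem_nabla)

lemma nabla_inject:
  "\<lbrakk>u \<in> sets M; v \<in> sets M\<rbrakk> \<Longrightarrow> nabla (sets_frame M) u = nabla (sets_frame M) v \<longleftrightarrow> u = v"
  by (auto simp: set_eq_subset nabla_subset_nabla_iff)

section \<open>Top, meets and joins of congruences\<close>

lemma top_Cong: "\<top>\<^bsub>Cong (sets_frame M)\<^esub> = nabla (sets_frame M) (space M)"
proof (rule top_eqI[OF partial_order_Cong])
  show "\<theta> \<sqsubseteq>\<^bsub>Cong (sets_frame M)\<^esub> nabla (sets_frame M) (space M)"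
    if "\<theta> \<in> carrier (Cong (sets_frame M))" for \<theta>
  proof -
    have \<theta>: "congruence (sets_frame M) \<theta>"
      using that by simp
    have "(x, y) \<in> nabla (sets_frame M) (space M)" if "(x, y) \<in> \<theta>" for x y
      using congruence_sets[OF \<theta> that] by (simp add: mem_nabla Un_absorb1 sets.sets_into_space)
    then show ?thesis
      by auto
  qed
qed (simp add: congruence_nabla)

lemma meet_Cong:
  assumes \<theta>: "congruence (sets_frame M) \<theta>" and \<eta>: "congruence (sets_frame M) \<eta>"
  shows "\<theta> \<sqinter>\<^bsub>Cong (sets_frame M)\<^esub> \<eta> = \<theta> \<inter> \<eta>"
proof (rule meet_eqI[OF partial_order_Cong])
  have "congruence (sets_frame M) (\<theta> \<inter> \<eta>)"
  proof (rule congruenceI)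
    show "x \<in> sets M \<and> y \<in> sets M" if "(x, y) \<in> \<theta> \<inter> \<eta>" for x y
      using that congruence_sets[OF \<theta>] by blast
    show "(x, x) \<in> \<theta> \<inter> \<eta>" if "x \<in> sets M" for x
      using that congruence_refl[OF \<theta>] congruence_refl[OF \<eta>] by blast
    show "(y, x) \<in> \<theta> \<inter> \<eta>" if "(x, y) \<in> \<theta> \<inter> \<eta>" for x y
      using that congruence_sym[OF \<theta>] congruence_sym[OF \<eta>] by blast
    show "(x, z) \<in> \<theta> \<inter> \<eta>" if "(x, y) \<in> \<theta> \<inter> \<eta>" "(y, z) \<in> \<theta> \<inter> \<eta>" for x y z
      using that congruence_trans[OF \<theta>] congruence_trans[OF \<eta>] by blast
    show "(x \<inter> y, x' \<inter> y') \<in> \<theta> \<inter> \<eta>" if "(x, x') \<in> \<theta> \<inter> \<eta>" "(y, y') \<in> \<theta> \<inter> \<eta>" for x x' y y'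
      using that congruence_Int[OF \<theta>] congruence_Int[OF \<eta>] by blast
    show "(\<Union> (fst ` C), \<Union> (snd ` C)) \<in> \<theta> \<inter> \<eta>" if "C \<subseteq> \<theta> \<inter> \<eta>" "countable C" for C
      using that congruence_Union[OF \<theta>] congruence_Union[OF \<eta>] by blast
  qed
  then show "\<theta> \<inter> \<eta> \<in> carrier (Cong (sets_frame M))"
    by simp
qed (use assms in auto)

text \<open>An upper bound collapses every member of \<open>C\<close>, hence their countable union,
  and so contains the congruence generated by that union.\<close>

lemma sup_nabla:
  assumes C: "C \<subseteq> sets M" "countable C"
  shows "\<Squnion>\<^bsub>Cong (sets_frame M)\<^esub> (nabla (sets_frame M) ` C) = nabla (sets_frame M) (\<Union> C)"
proof (rule sup_eqI[OF partial_order_Cong])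
  have U: "\<Union> C \<in> sets M"
    using C by (intro sets.countable_Union)
  then show "nabla (sets_frame M) (\<Union> C) \<in> carrier (Cong (sets_frame M))"
    by (simp add: congruence_nabla)
  show "nabla (sets_frame M) ` C \<subseteq> carrier (Cong (sets_frame M))"
    using C(1) congruence_nabla by (simp add: image_subset_iff) blast
  show "\<eta> \<sqsubseteq>\<^bsub>Cong (sets_frame M)\<^esub> nabla (sets_frame M) (\<Union> C)"
    if \<eta>: "\<eta> \<in> nabla (sets_frame M) ` C" for \<eta>
  proof -
    obtain u where "u \<in> C" "\<eta> = nabla (sets_frame M) u"
      using \<eta> by blast
    then show ?thesis
      using C(1) U by (simp add: nabla_subset_nabla_iff Union_upper subsetD)
  qed
  show "nabla (sets_frame M) (\<Union> C) \<sqsubseteq>\<^bsub>Cong (sets_frame M)\<^esub> \<theta>"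
    if \<theta>: "\<theta> \<in> carrier (Cong (sets_frame M))"
      and upper: "\<And>\<eta>. \<eta> \<in> nabla (sets_frame M) ` C \<Longrightarrow> \<eta> \<sqsubseteq>\<^bsub>Cong (sets_frame M)\<^esub> \<theta>" for \<theta>
  proof -
    have "(u, {}) \<in> \<theta>" if "u \<in> C" for u
      using that upper[of "nabla (sets_frame M) u"] \<theta> nabla_subset_iff[of u M \<theta>] subsetD[OF C(1), of u]
      by simp
    then have "(\<Union> C, {}) \<in> \<theta>"
      using \<theta> C(2) congruence_UN_empty[of M \<theta> C "\<lambda>u. u"] by simp
    then show ?thesis
      using \<theta> U by (simp add: nabla_subset_iff)
  qed
qed

lemma sigma_frame_hom_nabla:
  "sigma_frame_hom (sets_frame M) (Cong (sets_frame M)) (nabla (sets_frame M))"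
proof (rule sigma_frame_homI)
  show "nabla (sets_frame M) (x \<sqinter>\<^bsub>sets_frame M\<^esub> y) =
      nabla (sets_frame M) x \<sqinter>\<^bsub>Cong (sets_frame M)\<^esub> nabla (sets_frame M) y"
    if "x \<in> carrier (sets_frame M)" "y \<in> carrier (sets_frame M)" for x y
    using that by (auto simp: meet_Cong congruence_nabla mem_nabla)
qed (simp_all add: congruence_nabla top_Cong sup_nabla)

lemma bottom_Cong: "\<bottom>\<^bsub>Cong (sets_frame M)\<^esub> = Id_on (sets M)"
proof -
  have "\<bottom>\<^bsub>Cong (sets_frame M)\<^esub> = nabla (sets_frame M) {}"
    using sigma_frame_hom_bottom[OF sigma_frame_hom_nabla, of M] by simp
  also have "\<dots> = Id_on (sets M)"
    by (auto simp: nabla_def Id_on_def)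
  finally show ?thesis .
qed

text \<open>The sigma-ideal generated by two sigma-ideals consists of the measurable subsets of
  unions \<open>u \<union> v\<close> with one set from each. The formula is the congruence of that
  ideal: \<open>x\<close> and \<open>y\<close> agree outside some
  \<open>u \<union> v\<close>.\<close>

lemma join_Cong:
  assumes \<theta>: "congruence (sets_frame M) \<theta>" and \<eta>: "congruence (sets_frame M) \<eta>"
  shows "\<theta> \<squnion>\<^bsub>Cong (sets_frame M)\<^esub> \<eta> =
    {(x, y). x \<in> sets M \<and> y \<in> sets M \<and>
      (\<exists>u v. (u, {}) \<in> \<theta> \<and> (v, {}) \<in> \<eta> \<and> x \<union> (u \<union> v) = y \<union> (u \<union> v))}"
    (is "_ = ?J")
  unfolding join_def
proof (rule sup_eqI[OF partial_order_Cong])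
  have J: "(x, y) \<in> ?J"
    if "x \<in> sets M" "y \<in> sets M" "(u, {}) \<in> \<theta>" "(v, {}) \<in> \<eta>" "x \<union> (u \<union> v) = y \<union> (u \<union> v)" for x y u v
    using that by blast
  \<comment> \<open>Agreement outside a set persists when the set grows; different witnesses are
    compared after merging them.\<close>
  have mono: "x \<union> w' = y \<union> w'" if "x \<union> w = y \<union> w" "w \<subseteq> w'" for x y w w' :: "'a set"
    using that by blast
  have Un: "(u \<union> u', {}) \<in> \<theta>" if "(u, {}) \<in> \<theta>" "(u', {}) \<in> \<theta>" for u u'
    using congruence_Un[OF \<theta> that] by simp
  have Un': "(v \<union> v', {}) \<in> \<eta>" if "(v, {}) \<in> \<eta>" "(v', {}) \<in> \<eta>" for v v'
    using congruence_Un[OF \<eta> that] by simp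
  have emp: "({}, {}) \<in> \<theta>" "({}, {}) \<in> \<eta>"
    using congruence_refl[OF \<theta>] congruence_refl[OF \<eta>] by blast+
  have "congruence (sets_frame M) ?J"
  proof (rule congruenceI)
    show "(x, x) \<in> ?J" if "x \<in> sets M" for x
      by (rule J[OF that that emp]) simp
  next
    fix x y z assume "(x, y) \<in> ?J" "(y, z) \<in> ?J"
    then obtain u v u' v' where *: "x \<in> sets M" "z \<in> sets M" "(u, {}) \<in> \<theta>" "(v, {}) \<in> \<eta>"
      "(u', {}) \<in> \<theta>" "(v', {}) \<in> \<eta>" "x \<union> (u \<union> v) = y \<union> (u \<union> v)" "y \<union> (u' \<union> v') = z \<union> (u' \<union> v')"
      by blast
    have "x \<union> (u \<union> u' \<union> (v \<union> v')) = y \<union> (u \<union> u' \<union> (v \<union> v'))"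
      by (rule mono[OF *(7)]) auto
    also have "\<dots> = z \<union> (u \<union> u' \<union> (v \<union> v'))"
      by (rule mono[OF *(8)]) auto
    finally show "(x, z) \<in> ?J"
      by (rule J[OF *(1,2) Un[OF *(3,5)] Un'[OF *(4,6)]])
  next
    fix x x' y y' assume "(x, x') \<in> ?J" "(y, y') \<in> ?J"
    then obtain u v u' v' where *: "x \<in> sets M" "x' \<in> sets M" "y \<in> sets M" "y' \<in> sets M"
      "(u, {}) \<in> \<theta>" "(v, {}) \<in> \<eta>" "(u', {}) \<in> \<theta>" "(v', {}) \<in> \<eta>"
      "x \<union> (u \<union> v) = x' \<union> (u \<union> v)" "y \<union> (u' \<union> v') = y' \<union> (u' \<union> v')"
      by blast
    have "x \<union> (u \<union> u' \<union> (v \<union> v')) = x' \<union> (u \<union> u' \<union> (v \<union> v'))"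
      by (rule mono[OF *(9)]) auto
    moreover have "y \<union> (u \<union> u' \<union> (v \<union> v')) = y' \<union> (u \<union> u' \<union> (v \<union> v'))"
      by (rule mono[OF *(10)]) auto
    ultimately have "x \<inter> y \<union> (u \<union> u' \<union> (v \<union> v')) = x' \<inter> y' \<union> (u \<union> u' \<union> (v \<union> v'))"
      by (simp only: Un_Int_distrib2)
    then show "(x \<inter> y, x' \<inter> y') \<in> ?J"
      using *(1-4) by (intro J[OF _ _ Un[OF *(5,7)] Un'[OF *(6,8)]]) simp_all
  next
    fix C assume C: "C \<subseteq> ?J" "countable C"
    have "\<exists>u v. fst z \<in> sets M \<and> snd z \<in> sets M \<and> (u, {}) \<in> \<theta> \<and> (v, {}) \<in> \<eta> \<and>
        fst z \<union> (u \<union> v) = snd z \<union> (u \<union> v)" if "z \<in> C" for z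
      using subsetD[OF C(1) that] by (simp add: case_prod_beta)
    \<comment> \<open>Witnesses are chosen for every pair of the countable family; their unions are
      collapsed again by \<open>congruence_UN_empty\<close>.\<close>
    then obtain u v where *: "\<And>z. z \<in> C \<Longrightarrow> fst z \<in> sets M" "\<And>z. z \<in> C \<Longrightarrow> snd z \<in> sets M"
        "\<And>z. z \<in> C \<Longrightarrow> (u z, {}) \<in> \<theta>" "\<And>z. z \<in> C \<Longrightarrow> (v z, {}) \<in> \<eta>"
        "\<And>z. z \<in> C \<Longrightarrow> fst z \<union> (u z \<union> v z) = snd z \<union> (u z \<union> v z)"
      by metis
    show "(\<Union> (fst ` C), \<Union> (snd ` C)) \<in> ?J"
    proof (rule J[of _ _ "\<Union>z\<in>C. u z" "\<Union>z\<in>C. v z"])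
      show "\<Union> (fst ` C) \<in> sets M" "\<Union> (snd ` C) \<in> sets M"
        using C(2) *(1,2) by (auto intro!: sets.countable_UN')
      show "((\<Union>z\<in>C. u z), {}) \<in> \<theta>" "((\<Union>z\<in>C. v z), {}) \<in> \<eta>"
        using C(2) * by (auto intro!: congruence_UN_empty[OF \<theta>] congruence_UN_empty[OF \<eta>])
      show "\<Union> (fst ` C) \<union> ((\<Union>z\<in>C. u z) \<union> (\<Union>z\<in>C. v z)) =
          \<Union> (snd ` C) \<union> ((\<Union>z\<in>C. u z) \<union> (\<Union>z\<in>C. v z))"
        using *(5) by blast
    qed
  next
    show "x \<in> sets M \<and> y \<in> sets M" if "(x, y) \<in> ?J" for x y
      using that by blast
    show "(y, x) \<in> ?J" if xy: "(x, y) \<in> ?J" for x y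
    proof -
      obtain u v where *: "x \<in> sets M" "y \<in> sets M" "(u, {}) \<in> \<theta>" "(v, {}) \<in> \<eta>"
        "x \<union> (u \<union> v) = y \<union> (u \<union> v)"
        using xy by blast
      show ?thesis
        by (rule J[OF *(2,1,3,4) *(5)[symmetric]])
    qed
  qed
  then show "?J \<in> carrier (Cong (sets_frame M))"
    by simp
  show "{\<theta>, \<eta>} \<subseteq> carrier (Cong (sets_frame M))"
    using assms by simp
  show "\<zeta> \<sqsubseteq>\<^bsub>Cong (sets_frame M)\<^esub> ?J" if "\<zeta> \<in> {\<theta>, \<eta>}" for \<zeta>
  proof -
    \<comment> \<open>Witnesses: the symmetric difference of \<open>x\<close> and \<open>y\<close>
      on the side of \<open>\<theta>\<close>, the empty set on the side of
      \<open>\<eta>\<close>.\<close>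
    have "(x, y) \<in> ?J" if "(x, y) \<in> \<theta>" for x y
      by (rule J[OF _ _ congruence_symmetric_difference[OF \<theta> that] emp(2)])
        (use that congruence_sets[OF \<theta>] in auto)
    moreover have "(x, y) \<in> ?J" if "(x, y) \<in> \<eta>" for x y
      by (rule J[OF _ _ emp(1) congruence_symmetric_difference[OF \<eta> that]])
        (use that congruence_sets[OF \<eta>] in auto)
    ultimately show ?thesis
      using that unfolding le_Cong by auto
  qed
  show "?J \<sqsubseteq>\<^bsub>Cong (sets_frame M)\<^esub> \<zeta>"
    if \<zeta>: "\<zeta> \<in> carrier (Cong (sets_frame M))"
      and upper: "\<And>\<xi>. \<xi> \<in> {\<theta>, \<eta>} \<Longrightarrow> \<xi> \<sqsubseteq>\<^bsub>Cong (sets_frame M)\<^esub> \<zeta>" for \<zeta>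
  proof -
    have cong: "congruence (sets_frame M) \<zeta>" and "\<theta> \<subseteq> \<zeta>" "\<eta> \<subseteq> \<zeta>"
      using \<zeta> upper by simp_all
    then have "(u \<union> v, {}) \<in> \<zeta>" if "(u, {}) \<in> \<theta>" "(v, {}) \<in> \<eta>" for u v
      using congruence_Un[OF cong, of u "{}" v "{}"] that by auto
    then show ?thesis
      unfolding le_Cong using congruence_of_Un_eq[OF cong] by blast
  qed
qed

text \<open>
  If \<open>\<theta>\<close> and \<open>\<eta>\<close> are complementary, the join above relates \<open>space M\<close> to the empty set, which
  splits the space into a set collapsed by \<open>\<theta>\<close> and a set collapsed by \<open>\<eta>\<close>.
\<close>

lemma is_complement_Cong_cases:
  assumes "is_complement (Cong (sets_frame M)) \<theta> \<eta>"
  obtains u where "u \<in> sets M" "\<theta> = nabla (sets_frame M) u" "\<eta> = nabla (sets_frame M) (space M - u)"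
proof -
  have \<theta>: "congruence (sets_frame M) \<theta>" and \<eta>: "congruence (sets_frame M) \<eta>"
    using assms by (simp_all add: is_complement_def)
  have meet: "\<theta> \<inter> \<eta> = Id_on (sets M)"
    using assms by (simp add: is_complement_def meet_Cong[OF \<theta> \<eta>] bottom_Cong)
  have "(space M, {}) \<in> nabla (sets_frame M) (space M)"
    by (simp add: mem_nabla)
  then have "(space M, {}) \<in> \<theta> \<squnion>\<^bsub>Cong (sets_frame M)\<^esub> \<eta>"
    using assms by (simp add: is_complement_def top_Cong)
  then obtain u v where u: "(u, {}) \<in> \<theta>" and v: "(v, {}) \<in> \<eta>" and "space M \<union> (u \<union> v) = u \<union> v"
    by (auto simp: join_Cong[OF \<theta> \<eta>])
  have uv: "u \<in> sets M" "v \<in> sets M"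
    using u v congruence_sets[OF \<theta>] congruence_sets[OF \<eta>] by blast+
  have collapsed: "a = {}" if "(a, {}) \<in> \<theta>" "(a, {}) \<in> \<eta>" for a
  proof -
    have "(a, {}) \<in> Id_on (sets M)"
      using that meet by blast
    then show ?thesis
      by (simp add: Id_on_iff)
  qed
  have "u \<inter> v = {}"
    by (rule collapsed)
      (use congruence_Int[OF \<theta> u congruence_refl[OF \<theta> uv(2)]]
        congruence_Int[OF \<eta> congruence_refl[OF \<eta> uv(1)] v] in simp_all)
  then have v_eq: "v = space M - u"
    using \<open>space M \<union> (u \<union> v) = u \<union> v\<close> uv[THEN sets.sets_into_space] by blast
  \<comment> \<open>Stated for a general pair because it is applied twice, with
    \<open>\<theta>\<close> and \<open>\<eta>\<close> exchanged.\<close>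
  have "\<zeta> = nabla (sets_frame M) w"
    if \<zeta>: "congruence (sets_frame M) \<zeta>" and \<xi>: "congruence (sets_frame M) \<xi>"
      and w: "(w, {}) \<in> \<zeta>" and w': "(space M - w, {}) \<in> \<xi>"
      and *: "\<And>a. (a, {}) \<in> \<zeta> \<Longrightarrow> (a, {}) \<in> \<xi> \<Longrightarrow> a = {}" for \<zeta> \<xi> w
  proof
    have ws: "w \<in> sets M"
      using w congruence_sets[OF \<zeta>] by blast
    show "nabla (sets_frame M) w \<subseteq> \<zeta>"
      using w ws \<zeta> by (simp add: nabla_subset_iff)
    show "\<zeta> \<subseteq> nabla (sets_frame M) w"
    proof clarify
      fix x y assume xy: "(x, y) \<in> \<zeta>"
      then have xys: "x \<in> sets M" "y \<in> sets M"
        using congruence_sets[OF \<zeta>] by blast+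
      \<comment> \<open>\<open>d\<close> is collapsed by \<open>\<zeta>\<close> as part of the
        symmetric difference and by \<open>\<xi>\<close> as part of \<open>space M - w\<close>.
        Hence it is empty, and \<open>x\<close> and \<open>y\<close> agree outside
        \<open>w\<close>.\<close>
      define d where "d = ((x - y) \<union> (y - x)) \<inter> (space M - w)"
      have "(d, {} \<inter> (space M - w)) \<in> \<zeta>"
        unfolding d_def using ws
        by (intro congruence_Int[OF \<zeta>] congruence_symmetric_difference[OF \<zeta> xy] congruence_refl[OF \<zeta>]) auto
      moreover have "(d, ((x - y) \<union> (y - x)) \<inter> {}) \<in> \<xi>"
        unfolding d_def using xys
        by (intro congruence_Int[OF \<xi> _ w'] congruence_refl[OF \<xi>]) auto
      ultimately have "d = {}"
        using * by simp
      then show "(x, y) \<in> nabla (sets_frame M) w"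
        using ws xys xys[THEN sets.sets_into_space] by (auto simp: mem_nabla d_def)
    qed
  qed
  note collapse_eq = this
  have "space M - (space M - u) = u"
    using uv[THEN sets.sets_into_space] by blast
  then show ?thesis
    using that[OF uv(1)] collapse_eq[OF \<theta> \<eta> u] collapse_eq[OF \<eta> \<theta> v] u v collapsed v_eq by simp
qed

text \<open>Uniqueness of complements comes from the classification of complementary pairs and
  injectivity of \<open>nabla\<close>, rather than from distributivity of the congruence
  lattice.\<close>

interpretation nabla: complement_hom M "Cong (sets_frame M)" "nabla (sets_frame M)" for M
proof
  show "b = nabla (sets_frame M) (space M - a)"
    if "a \<in> sets M" "is_complement (Cong (sets_frame M)) (nabla (sets_frame M) a) b" for a b
    using that(2)
  proof (cases rule: is_complement_Cong_cases)
    case (1 u)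
    then show ?thesis
      using that(1) nabla_inject[of a M u] by simp
  qed
qed (rule sigma_frame_hom_nabla)

interpretation identity: complement_hom M "sets_frame M" "\<lambda>a. a" for M
proof
  show "sigma_frame_hom (sets_frame M) (sets_frame M) (\<lambda>a. a)"
    by (rule sigma_frame_homI) simp_all
  show "b = space M - a" if "a \<in> sets M" "is_complement (sets_frame M) a b" for a b
    using that sets.sets_into_space[of b M] by (auto simp: is_complement_def)
qed


section \<open>Simpson's extension on open sublocales\<close>

text \<open>Both relations say that two sets agree on \<open>a\<close>. Thus the complement of
  \<open>nabla\<close> at \<open>a\<close> is the congruence of the open sublocale of
  \<open>a\<close>, at which the localic integral evaluates the measure.\<close>

lemma nabla_compl_eq_delta:
  assumes "a \<in> sets M"
  shows "nabla (sets_frame M) (space M - a) = delta (sets_frame M) a"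
proof -
  have "x \<union> (space M - a) = y \<union> (space M - a) \<longleftrightarrow> x \<inter> a = y \<inter> a"
    if "x \<in> sets M" "y \<in> sets M" for x y
    using that[THEN sets.sets_into_space] sets.sets_into_space[OF assms] by blast
  then have "(x, y) \<in> nabla (sets_frame M) (space M - a) \<longleftrightarrow> (x, y) \<in> delta (sets_frame M) a" for x y
    using assms by (simp add: nabla_def delta_def cong: conj_cong)
  then show ?thesis
    by auto
qed

text \<open>The order of sublocales reverses inclusion of congruences, so the infimum runs over the
  measurable supersets of \<open>B\<close>; by monotonicity it is attained at \<open>B\<close>
  itself.\<close>

lemma simpson_ext_open_subloc:
  assumes B: "B \<in> sets M"
  shows "simpson_ext (sets_frame M) (emeasure M) (open_subloc (sets_frame M) B) = emeasure M B"
proof -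
  have "delta (sets_frame M) a \<subseteq> delta (sets_frame M) B \<longleftrightarrow> B \<subseteq> a" if a: "a \<in> sets M" for a
  proof -
    have "delta (sets_frame M) a \<subseteq> delta (sets_frame M) B \<longleftrightarrow> space M - a \<subseteq> space M - B"
      using a B by (simp add: nabla_subset_nabla_iff flip: nabla_compl_eq_delta)
    also have "\<dots> \<longleftrightarrow> B \<subseteq> a"
      using sets.sets_into_space[OF B] by blast
    finally show ?thesis .
  qed
  then have "{a \<in> carrier (sets_frame M). open_subloc (sets_frame M) B \<sqsubseteq>\<^bsub>Subloc (sets_frame M)\<^esub>
      open_subloc (sets_frame M) a} = {a \<in> sets M. B \<subseteq> a}"
    by (auto simp: Subloc_def open_subloc_def)
  then show ?thesis
    unfolding simpson_ext_def using B
    by (intro antisym INF_lower2[of B] INF_greatest) (auto intro: emeasure_mono)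
qed

section \<open>Simple functions and their canonical forms\<close>

text \<open>The coefficients lie in a general semiring because both \<open>real\<close> and
  \<open>ennreal\<close> sums are evaluated this way.\<close>

lemma sum_indicator_disjoint_family:
  fixes c :: "'i \<Rightarrow> 'a :: semiring_1"
  assumes "finite I" "disjoint_family_on B I" "j \<in> I" "x \<in> B j"
  shows "(\<Sum>i\<in>I. c i * indicator (B i) x) = c j"
proof -
  have "(\<Sum>i\<in>I. c i * indicator (B i) x) = (\<Sum>i\<in>I. if i = j then c j else 0)"
    using assms by (intro sum.cong) (auto simp: disjoint_family_on_def indicator_def)
  then show ?thesis
    using assms by simp
qed

lemma simple_integral_step_function:
  fixes c :: "nat \<Rightarrow> real"
  assumes B: "\<And>i. i \<in> {1..n} \<Longrightarrow> B i \<in> sets M"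
    and disj: "disjoint_family_on B {1..n}" and cover: "(\<Union>i\<in>{1..n}. B i) = space M"
    and g: "\<And>x. x \<in> space M \<Longrightarrow> g x = (\<Sum>i = 1..n. c i * indicator (B i) x)"
  shows "integral\<^sup>S M (\<lambda>x. ennreal (g x)) = (\<Sum>i = 1..n. ennreal (c i) * emeasure M (B i))"
proof -
  \<comment> \<open>\<open>ennreal\<close> is not additive on mixed signs; it passes through this
    sum because disjointness leaves at most one nonzero summand at each point.\<close>
  have eq: "ennreal (g x) = (\<Sum>i = 1..n. ennreal (c i) * indicator (B i) x)" if x: "x \<in> space M" for x
  proof -
    obtain j where "j \<in> {1..n}" "x \<in> B j"
      using x cover by blast
    then show ?thesis
      unfolding g[OF x]
      by (simp only: sum_indicator_disjoint_family[OF finite_atLeastAtMost disj])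
  qed
  have simple: "simple_function M (\<lambda>x. \<Sum>i = 1..n. ennreal (c i) * indicator (B i) x)"
    by (intro simple_function_sum simple_function_mult simple_function_const simple_function_indicator B)
  have "integral\<^sup>S M (\<lambda>x. ennreal (g x)) =
      integral\<^sup>S M (\<lambda>x. \<Sum>i = 1..n. ennreal (c i) * indicator (B i) x)"
    by (rule simple_integral_cong) (rule eq)
  also have "\<dots> = (\<integral>\<^sup>+x. (\<Sum>i = 1..n. ennreal (c i) * indicator (B i) x) \<partial>M)"
    by (rule nn_integral_eq_simple_integral[OF simple, symmetric])
  also have "\<dots> = (\<Sum>i = 1..n. \<integral>\<^sup>+x. ennreal (c i) * indicator (B i) x \<partial>M)"
    using B by (intro nn_integral_sum) simp
  also have "\<dots> = (\<Sum>i = 1..n. ennreal (c i) * emeasure M (B i))"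
    using B by (intro sum.cong nn_integral_cmult_indicator) auto
  finally show ?thesis .
qed

lemma SM_I:
  assumes "f \<in> MF N" "\<And>i. i \<in> {1..n} \<Longrightarrow> complemented N (a i)" "f = simple_sum N n r a"
  shows "f \<in> SM N"
  unfolding SM_def using assms by (intro CollectI conjI exI ballI)

text \<open>The pieces are the level sets of \<open>g\<close>, listed by increasing value, so they
  are nonempty and carry distinct coefficients. On an empty space this gives
  \<open>n = 0\<close>.\<close>

lemma simple_function_canonical_form:
  fixes g :: "'x \<Rightarrow> real"
  assumes g: "simple_function M g" and rat: "g ` space M \<subseteq> \<rat>"
  obtains n :: nat and r :: "nat \<Rightarrow> rat" and B :: "nat \<Rightarrow> 'x set"
  where "strict_mono_on {1..n} r" "\<And>i. i \<in> {1..n} \<Longrightarrow> B i \<in> sets M"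
    "\<And>i. i \<in> {1..n} \<Longrightarrow> B i \<noteq> {}" "disjoint_family_on B {1..n}" "(\<Union>i\<in>{1..n}. B i) = space M"
    "\<And>x. x \<in> space M \<Longrightarrow> g x = (\<Sum>i = 1..n. of_rat (r i) * indicator (B i) x)"
proof -
  define V where "V = {q. (of_rat q :: real) \<in> g ` space M}"
  have "inj (of_rat :: rat \<Rightarrow> real)"
    by (simp add: inj_on_def)
  then have "finite V"
    unfolding V_def using finite_vimageI[OF simple_functionD(1)[OF g]] by (simp add: vimage_def)
  define h where "h i = sorted_list_of_set V ! i" for i
  have h: "bij_betw h {..<card V} V"
    unfolding h_def using \<open>finite V\<close> by (intro bij_betw_nth) auto
  have mono: "strict_mono_on {..<card V} h"
    unfolding h_def
    by (rule strict_mono_onI)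
      (simp add: sorted_wrt_nth_less[OF sorted_list_of_set.strict_sorted_key_list_of_set])
  \<comment> \<open>Shift from list positions, which start at 0, to the indices
    \<open>1..card V\<close>.\<close>
  define r where "r i = h (i - 1)" for i
  define B where "B i = g -` {of_rat (r i)} \<inter> space M" for i
  have V: "V = r ` {1..card V}"
  proof -
    have "r ` {1..card V} = h ` {..<card V}"
      by (simp add: r_def image_image del: One_nat_def flip: image_Suc_lessThan)
    then show ?thesis
      using bij_betw_imp_surj_on[OF h] by simp
  qed
  have r_mono: "strict_mono_on {1..card V} r"
    unfolding r_def by (rule strict_mono_onI) (auto intro!: strict_mono_onD[OF mono])
  have disj: "disjoint_family_on B {1..card V}"
    unfolding disjoint_family_on_def
  proof (intro ballI impI)
    fix i j assume "i \<in> {1..card V}" "j \<in> {1..card V}" "i \<noteq> j"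
    then have "r i \<noteq> r j"
      using strict_mono_on_imp_inj_on[OF r_mono] by (auto dest: inj_onD)
    then show "B i \<inter> B j = {}"
      by (auto simp: B_def)
  qed
  have cover: "(\<Union>i\<in>{1..card V}. B i) = space M"
  proof -
    have "\<exists>i\<in>{1..card V}. x \<in> B i" if x: "x \<in> space M" for x
    proof -
      obtain q where q: "g x = of_rat q"
        using rat x by (auto elim: Rats_cases)
      then have "q \<in> V"
        using x by (auto simp: V_def intro: rev_image_eqI)
      then show ?thesis
        using q x by (subst (asm) V) (auto simp: B_def)
    qed
    then show ?thesis
      by (auto simp: B_def)
  qed
  show thesis
  proof (rule that[OF r_mono _ _ disj cover])
    show "B i \<in> sets M" for i
      unfolding B_def by (rule simple_functionD(2)[OF g])
    show "B i \<noteq> {}" if "i \<in> {1..card V}" for i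
    proof -
      have "r i \<in> V"
        using that by (subst V) blast
      then show ?thesis
        by (auto simp: V_def B_def)
    qed
    show "g x = (\<Sum>i = 1..card V. of_rat (r i) * indicator (B i) x)"
      if x: "x \<in> space M" for x
    proof -
      obtain j where j: "j \<in> {1..card V}" "x \<in> B j"
        using x cover by blast
      have "g x = of_rat (r j)"
        using j(2) by (simp add: B_def)
      also have "\<dots> = (\<Sum>i = 1..card V. of_rat (r i) * indicator (B i) x)"
        by (rule sum_indicator_disjoint_family[OF finite_atLeastAtMost disj j, symmetric])
      finally show ?thesis .
    qed
  qed
qed

section \<open>Canonical forms over the congruence frame\<close>

lemma canonical_form_nablaI:
  assumes r: "strict_mono_on {1..n} r" and B: "\<And>i. i \<in> {1..n} \<Longrightarrow> B i \<in> sets M"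
    and ne: "\<And>i. i \<in> {1..n} \<Longrightarrow> B i \<noteq> {}"
    and disj: "disjoint_family_on B {1..n}" and cover: "(\<Union>i\<in>{1..n}. B i) = space M"
    and g: "\<And>x. x \<in> space M \<Longrightarrow> g x = (\<Sum>i = 1..n. of_rat (r i) * indicator (B i) x)"
  shows "canonical_form (Cong (sets_frame M)) (nabla (sets_frame M) \<circ> preimage_hom M g) n r
    (\<lambda>i. nabla (sets_frame M) (B i))"
  unfolding canonical_form_def
proof (intro conjI ballI impI)
  show "nabla (sets_frame M) \<circ> preimage_hom M g =
      simple_sum (Cong (sets_frame M)) n r (\<lambda>i. nabla (sets_frame M) (B i))"
  proof -
    have "preimage_hom M g = preimage_hom M (\<lambda>x. \<Sum>i = 1..n. of_rat (r i) * indicator (B i) x)"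
      by (rule preimage_hom_cong) (rule g)
    then show ?thesis
      by (simp only: nabla.simple_sum_phi[OF refl B])
  qed
  show "complemented (Cong (sets_frame M)) (nabla (sets_frame M) (B i))" if "i \<in> {1..n}" for i
    by (rule nabla.complemented_phi[OF B[OF that]])
  show "nabla (sets_frame M) (B i) \<noteq> \<bottom>\<^bsub>Cong (sets_frame M)\<^esub>" if "i \<in> {1..n}" for i
    using B[OF that] ne[OF that] by (simp add: nabla_inject flip: nabla.phi_bottom)
  show "nabla (sets_frame M) (B i) \<sqinter>\<^bsub>Cong (sets_frame M)\<^esub> nabla (sets_frame M) (B j) =
      \<bottom>\<^bsub>Cong (sets_frame M)\<^esub>" if "i \<in> {1..n}" "j \<in> {1..n}" "i \<noteq> j" for i j
    using B[OF that(1)] B[OF that(2)] disjoint_family_onD[OF disj that]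
    by (simp add: nabla.phi_meet nabla.phi_bottom)
  show "\<Squnion>\<^bsub>Cong (sets_frame M)\<^esub> ((\<lambda>i. nabla (sets_frame M) (B i)) ` {1..n}) = \<top>\<^bsub>Cong (sets_frame M)\<^esub>"
    using nabla.phi_sup[where M = M and I = "{1..n}" and B = B] B cover
    by (simp add: countable_finite nabla.phi_top)
qed (rule r)

text \<open>Each complemented \<open>a i\<close> comes from a measurable set; injectivity of
  \<open>nabla\<close> then carries disjointness, covering and the sum back to the space.\<close>

lemma canonical_form_nablaE:
  assumes g: "g \<in> borel_measurable M"
    and canon: "canonical_form (Cong (sets_frame M)) (nabla (sets_frame M) \<circ> preimage_hom M g) n r a"
  obtains B where "\<And>i. i \<in> {1..n} \<Longrightarrow> a i = nabla (sets_frame M) (B i)"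
    "\<And>i. i \<in> {1..n} \<Longrightarrow> B i \<in> sets M"
    "disjoint_family_on B {1..n}" "(\<Union>i\<in>{1..n}. B i) = space M"
    "\<And>x. x \<in> space M \<Longrightarrow> g x = (\<Sum>i = 1..n. of_rat (r i) * indicator (B i) x)"
proof -
  have "\<exists>u. u \<in> sets M \<and> a i = nabla (sets_frame M) u" if i: "i \<in> {1..n}" for i
  proof -
    have "complemented (Cong (sets_frame M)) (a i)"
      using canon i by (simp add: canonical_form_def)
    then show ?thesis
      unfolding complemented_def by (meson is_complement_Cong_cases)
  qed
  then obtain B where B: "\<And>i. i \<in> {1..n} \<Longrightarrow> B i \<in> sets M"
      and a: "\<And>i. i \<in> {1..n} \<Longrightarrow> a i = nabla (sets_frame M) (B i)"
    by metis
  show thesis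
  proof (rule that[OF a B])
    show "disjoint_family_on B {1..n}"
      unfolding disjoint_family_on_def
    proof (intro ballI impI)
      fix i j assume ij: "i \<in> {1..n}" "j \<in> {1..n}" "i \<noteq> j"
      then have "a i \<sqinter>\<^bsub>Cong (sets_frame M)\<^esub> a j = \<bottom>\<^bsub>Cong (sets_frame M)\<^esub>"
        using canon unfolding canonical_form_def by blast
      then have "nabla (sets_frame M) (B i \<inter> B j) = nabla (sets_frame M) {}"
        by (simp add: a[OF ij(1)] a[OF ij(2)] nabla.phi_meet[OF B[OF ij(1)] B[OF ij(2)]] nabla.phi_bottom)
      then show "B i \<inter> B j = {}"
        using B[OF ij(1)] B[OF ij(2)] by (simp add: nabla_inject)
    qed
    have U: "(\<Union>i\<in>{1..n}. B i) \<in> sets M"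
      using B by (intro sets.finite_UN) auto
    have "a ` {1..n} = (\<lambda>i. nabla (sets_frame M) (B i)) ` {1..n}"
      by (rule image_cong[OF refl a])
    then have "\<Squnion>\<^bsub>Cong (sets_frame M)\<^esub> ((\<lambda>i. nabla (sets_frame M) (B i)) ` {1..n}) =
        \<top>\<^bsub>Cong (sets_frame M)\<^esub>"
      using canon by (simp add: canonical_form_def)
    then have "nabla (sets_frame M) (\<Union>i\<in>{1..n}. B i) = nabla (sets_frame M) (space M)"
      using nabla.phi_sup[where M = M and I = "{1..n}" and B = B] B
      by (simp add: countable_finite nabla.phi_top)
    then show "(\<Union>i\<in>{1..n}. B i) = space M"
      using U by (simp add: nabla_inject)
    \<comment> \<open>The classical function read off from the canonical form. \<open>nabla\<close>
      cancels at each argument \<open>t\<close>, and equal preimage maps make \<open>g\<close> and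
      \<open>k\<close> agree on the space.\<close>
    define k where "k = (\<lambda>x. \<Sum>i = 1..n. of_rat (r i) * indicator (B i) x :: real)"
    have k: "k \<in> borel_measurable M"
      unfolding k_def using B by (intro borel_measurable_sum borel_measurable_times) auto
    have "nabla (sets_frame M) \<circ> preimage_hom M g = nabla (sets_frame M) \<circ> preimage_hom M k"
      using canon nabla.simple_sum_phi[OF a B] by (simp add: canonical_form_def k_def)
    then have "preimage_hom M g t = preimage_hom M k t" for t
      using preimage_hom_sets[OF g] preimage_hom_sets[OF k]
      by (simp add: fun_eq_iff nabla_inject)
    then show "g x = (\<Sum>i = 1..n. of_rat (r i) * indicator (B i) x)" if "x \<in> space M" for x
      using preimage_hom_inject[of M g k x] that by (simp add: fun_eq_iff k_def)
  qed
qed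

text \<open>The description asks for one value shared by all canonical forms. Each of them is a step
  representation of \<open>g\<close> and so yields the classical integral, while level sets provide
  at least one. Negative coefficients become 0 under \<open>ennreal\<close> on both sides
  alike.\<close>

lemma localic_nn_integral_nabla:
  assumes g: "simple_function M g" "g ` space M \<subseteq> \<rat>"
  shows "localic_nn_integral (sets_frame M) (simpson_ext (sets_frame M) (emeasure M))
      (nabla (sets_frame M) \<circ> preimage_hom M g) = integral\<^sup>S M (\<lambda>x. ennreal (g x))"
    (is "localic_nn_integral ?L ?lam _ = _")
proof -
  have lam: "?lam (compl (Cong ?L) (nabla ?L u)) = emeasure M u" if "u \<in> sets M" for u
    using simpson_ext_open_subloc[OF that]
    by (simp add: nabla.compl_phi[OF that] nabla_compl_eq_delta[OF that] open_subloc_def)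
  have value_eq: "(\<Sum>i = 1..n. ennreal (of_rat (r i)) * ?lam (compl (Cong ?L) (a i))) =
      integral\<^sup>S M (\<lambda>x. ennreal (g x))"
    if "canonical_form (Cong ?L) (nabla ?L \<circ> preimage_hom M g) n r a" for n r a
  proof (rule canonical_form_nablaE[OF borel_measurable_simple_function[OF g(1)] that])
    fix B assume a: "\<And>i. i \<in> {1..n} \<Longrightarrow> a i = nabla ?L (B i)"
      and B: "\<And>i. i \<in> {1..n} \<Longrightarrow> B i \<in> sets M"
      and *: "disjoint_family_on B {1..n}" "(\<Union>i\<in>{1..n}. B i) = space M"
        "\<And>x. x \<in> space M \<Longrightarrow> g x = (\<Sum>i = 1..n. of_rat (r i) * indicator (B i) x)"
    have "integral\<^sup>S M (\<lambda>x. ennreal (g x)) = (\<Sum>i = 1..n. ennreal (of_rat (r i)) * emeasure M (B i))"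
      by (rule simple_integral_step_function[OF B *])
    then show ?thesis
      using a B lam by simp
  qed
  have "\<exists>n r a. canonical_form (Cong ?L) (nabla ?L \<circ> preimage_hom M g) n r a"
  proof (rule simple_function_canonical_form[OF g])
    fix n :: nat and r :: "nat \<Rightarrow> rat" and B :: "nat \<Rightarrow> 'a set"
    assume *: "strict_mono_on {1..n} r" "\<And>i. i \<in> {1..n} \<Longrightarrow> B i \<in> sets M"
      "\<And>i. i \<in> {1..n} \<Longrightarrow> B i \<noteq> {}" "disjoint_family_on B {1..n}" "(\<Union>i\<in>{1..n}. B i) = space M"
      "\<And>x. x \<in> space M \<Longrightarrow> g x = (\<Sum>i = 1..n. of_rat (r i) * indicator (B i) x)"
    show ?thesis
      using canonical_form_nablaI[OF *] by blast
  qed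
  then obtain n r a where canon: "canonical_form (Cong ?L) (nabla ?L \<circ> preimage_hom M g) n r a"
    by blast
  show ?thesis
    unfolding localic_nn_integral_def
  proof (rule the_equality)
    show "\<exists>n r a. canonical_form (Cong ?L) (nabla ?L \<circ> preimage_hom M g) n r a \<and>
        integral\<^sup>S M (\<lambda>x. ennreal (g x)) =
          (\<Sum>i = 1..n. ennreal (of_rat (r i)) * ?lam (compl (Cong ?L) (a i)))"
      using canon value_eq[OF canon, symmetric] by blast
  qed (use value_eq in blast)
qed

theorem mainTheorem4:
  fixes M :: "'x measure" and n :: nat and r :: "nat \<Rightarrow> rat" and A :: "nat \<Rightarrow> 'x set"
    and ft :: "'x \<Rightarrow> real"
    and L :: "'x set gorder" and lam :: "('x set \<times> 'x set) set \<Rightarrow> ennreal"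
    and f :: "lreal \<Rightarrow> 'x set" and F :: "lreal \<Rightarrow> ('x set \<times> 'x set) set"
  assumes r_mono: "strict_mono_on {1..n} r"
    and A_sets: "\<And>i. i \<in> {1..n} \<Longrightarrow> A i \<in> sets M"
    and A_disj: "disjoint_family_on A {1..n}"
    and A_cover: "(\<Union>i \<in> {1..n}. A i) = space M"
    and ft: "ft = (\<lambda>x. \<Sum>i = 1..n. of_rat (r i) * indicator (A i) x)"
    and L: "L = sets_frame M"
    and lam: "lam = simpson_ext L (emeasure M)"
    and f: "f = localic_counterpart M ft"
    and F: "F = nabla L \<circ> f"
  shows "(\<forall>B \<in> sets M. lam (open_subloc L B) = emeasure M B)
    \<and> f \<in> MF L
    \<and> (\<forall>p. f (gt p) = ft -` {of_rat p<..} \<inter> space M)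
    \<and> (\<forall>q. f (lt q) = ft -` {..<of_rat q} \<inter> space M)
    \<and> f \<in> SM L
    \<and> f = simple_sum L n r A
    \<and> F \<in> SM (Cong L)
    \<and> F = simple_sum (Cong L) n r (\<lambda>i. nabla L (A i))
    \<and> ((\<forall>x \<in> space M. 0 \<le> ft x) \<longrightarrow>
         mf_nonneg (Cong L) F
         \<and> integral\<^sup>S M (\<lambda>x. ennreal (ft x)) = localic_nn_integral L lam F)
    \<and> (classical_integrable M ft \<longleftrightarrow> localic_integrable L lam F)
    \<and> (classical_integrable M ft \<longrightarrow> classical_integral M ft = localic_integral L lam F)"
proof -
  have simple: "simple_function M ft"
    unfolding ft using A_sets
    by (intro simple_function_sum simple_function_mult simple_function_const simple_function_indicator)
  then have ft_borel: "ft \<in> borel_measurable M"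
    by (rule borel_measurable_simple_function)
  \<comment> \<open>Rationality of the values is what gives the level sets of \<open>ft\<close> and
    of its two parts rational coefficients.\<close>
  have "ft x = of_rat (\<Sum>i = 1..n. r i * indicator (A i) x)" for x
    unfolding ft of_rat_sum of_rat_mult by (intro sum.cong) (auto simp: indicator_def)
  then have rat: "ft x \<in> \<rat>" for x
    by simp
  have f_eq: "f = preimage_hom M ft"
    unfolding f by (rule localic_counterpart_eq[OF ft_borel])
  have F_eq: "F = nabla (sets_frame M) \<circ> preimage_hom M ft"
    by (simp add: F f_eq L)
  have f_sum: "f = simple_sum L n r A"
    using identity.simple_sum_phi[OF refl A_sets, where r = r]
    unfolding f_eq L ft by (simp add: comp_def del: sum_mult_indicator)
  have F_sum: "F = simple_sum (Cong L) n r (\<lambda>i. nabla L (A i))"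
    unfolding F_eq L ft by (rule nabla.simple_sum_phi[OF refl A_sets, symmetric])
  have f_MF: "f \<in> MF L"
    unfolding f_eq L by (rule preimage_hom_MF[OF ft_borel])
  have f_SM: "f \<in> SM L"
    by (rule SM_I[OF f_MF _ f_sum]) (simp add: L identity.complemented_phi[OF A_sets])
  have F_SM: "F \<in> SM (Cong L)"
  proof (rule SM_I[OF _ _ F_sum])
    show "F \<in> MF (Cong L)"
      unfolding F_eq L by (rule nabla.MF_phi[OF ft_borel])
    show "complemented (Cong L) (nabla L (A i))" if "i \<in> {1..n}" for i
      unfolding L by (rule nabla.complemented_phi[OF A_sets[OF that]])
  qed
  have nn: "localic_nn_integral L lam (nabla (sets_frame M) \<circ> preimage_hom M g) =
      integral\<^sup>S M (\<lambda>x. ennreal (g x))" if "simple_function M g" "\<And>x. g x \<in> \<rat>" for g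
    unfolding L lam using localic_nn_integral_nabla[of M g] that by (simp add: image_subset_iff)
  have "simple_function M (\<lambda>x. max (ft x) 0)" "simple_function M (\<lambda>x. max (- ft x) 0)"
    using simple_function_compose1[OF simple, of "\<lambda>y. max y 0"]
      simple_function_compose1[OF simple, of "\<lambda>y. max (- y) 0"] by simp_all
  moreover have "max (ft x) 0 \<in> \<rat>" "max (- ft x) 0 \<in> \<rat>" for x
    using rat[of x] by (simp_all add: max_def)
  ultimately have pos: "localic_nn_integral L lam (mf_pos (Cong L) F) =
      integral\<^sup>S M (\<lambda>x. ennreal (max (ft x) 0))"
    and neg: "localic_nn_integral L lam (mf_negpart (Cong L) F) =
      integral\<^sup>S M (\<lambda>x. ennreal (max (- ft x) 0))"
    using nn[of "\<lambda>x. max (ft x) 0"] nn[of "\<lambda>x. max (- ft x) 0"]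
      nabla.mf_pos_phi[OF ft_borel] nabla.mf_negpart_phi[OF ft_borel]
    by (simp_all only: F_eq L)
  have "mf_nonneg (Cong L) F" if "\<forall>x\<in>space M. 0 \<le> ft x"
  proof -
    \<comment> \<open>Deleting \<open>of_rat_less_0_iff\<close> keeps \<open>of_rat p < 0\<close> an
      inequality of reals, to be chained with \<open>0 \<le> ft x\<close>.\<close>
    have "preimage_hom M (\<lambda>_. 0) (gt p) \<subseteq> preimage_hom M ft (gt p)" for p
      using that by (auto simp: preimage_hom_gt simp del: of_rat_less_0_iff intro: less_le_trans)
    then show ?thesis
      unfolding mf_nonneg_def mf_le_def L nabla.mf_zero_phi F_eq
      by (simp add: nabla_subset_nabla_iff preimage_hom_sets ft_borel)
  qed
  moreover have "integral\<^sup>S M (\<lambda>x. ennreal (ft x)) = localic_nn_integral L lam F"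
    unfolding F_eq by (rule nn[OF simple rat, symmetric])
  moreover have "\<forall>B\<in>sets M. lam (open_subloc L B) = emeasure M B"
    by (simp add: lam L simpson_ext_open_subloc)
  moreover have "classical_integrable M ft \<longleftrightarrow> localic_integrable L lam F"
    using simple F_SM by (simp add: classical_integrable_def localic_integrable_def pos neg)
  moreover have "classical_integral M ft = localic_integral L lam F"
    by (simp add: classical_integral_def localic_integral_def pos neg)
  moreover have "f (gt p) = ft -` {of_rat p<..} \<inter> space M" "f (lt p) = ft -` {..<of_rat p} \<inter> space M" for p
    by (simp_all add: f_eq preimage_hom_def)
  ultimately show ?thesis
    using f_MF f_SM f_sum F_SM F_sum by blast
qed

end
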